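(* Let $R$ be a commutative Noetherian ring. If the one-variable formal power-series ring $R[[x]]$ is a unique factorization domain, then the two-variable formal power-series ring $R[[x,y]]$ is a unique factorization domain.
   Context: Rings are commutative with identity. *)

theory Defs
  imports
    "HOL-Computational_Algebra.Formal_Power_Series"
    "HOL-Algebra.Ring_Divisibility"
    "HOL-Algebra.Algebraic_Closure_Type"
begin

unbundle fps_syntax

text \<open>
  The two-variable ring \<open>R[[x,y]]\<close> is the type \<open>'a fps fps\<close>, that is \<open>R[[x]][[y]]\<close>; the
  coefficient of \<open>x^i y^j\<close> in \<open>f\<close> is \<open>f $ j $ i\<close>. The next two lemmas show that this is the
  ring of all doubly indexed coefficient families with the Cauchy product in both indices.
\<close>

lemma bij_fps_fps_coeffs:
  "bij (\<lambda>(f :: 'a :: comm_ring_1 fps fps) i j. f $ j $ i)"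
proof (rule bijI)
  show "inj (\<lambda>(f :: 'a fps fps) i j. f $ j $ i)"
    by (auto simp: inj_def fun_eq_iff fps_eq_iff)
  show "surj (\<lambda>(f :: 'a fps fps) i j. f $ j $ i)"
  proof (rule surjI)
    fix c :: "nat \<Rightarrow> nat \<Rightarrow> 'a"
    show "(\<lambda>i j. Abs_fps (\<lambda>j. Abs_fps (\<lambda>i. c i j)) $ j $ i) = c"
      by simp
  qed
qed

lemma fps_fps_ring_ops_nth:
  fixes f g :: "'a :: comm_ring_1 fps fps"
  shows "(0 :: 'a fps fps) $ j $ i = 0"
    and "(1 :: 'a fps fps) $ j $ i = (if i = 0 \<and> j = 0 then 1 else 0)"
    and "(f + g) $ j $ i = f $ j $ i + g $ j $ i"
    and "(f * g) $ j $ i = (\<Sum>k\<le>i. \<Sum>l\<le>j. f $ l $ k * g $ (j - l) $ (i - k))"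
proof -
  show "(f * g) $ j $ i = (\<Sum>k\<le>i. \<Sum>l\<le>j. f $ l $ k * g $ (j - l) $ (i - k))"
    by (simp add: fps_mult_nth fps_sum_nth atLeast0AtMost sum.swap [of _ "{..j}"])
qed auto

end

theory Submission
  imports Defs
begin

text \<open>
  Write \<open>A = R[[x]]\<close> and \<open>B = A[[y]]\<close>. Since \<open>B\<close> is a Noetherian domain, it suffices that an
  irreducible \<open>a\<close> in \<open>B\<close> is prime. Choose \<open>b\<close> such that the colon ideal \<open>Q = (a : b)\<close> is a proper
  prime ideal. If \<open>s Q \<subseteq> g B\<close> for some \<open>g\<close> in \<open>Q\<close> and some product \<open>s\<close> of primes, then the primes
  in \<open>s\<close> can be cancelled one by one, and \<open>a\<close> is prime.

  If \<open>e(x, 0)\<close> is a unit times \<open>x^m\<close>, then \<open>e\<close> is a product of primes: for irreducible \<open>e\<close> and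
  \<open>Q = (e : b)\<close>, Weierstrass division by \<open>e\<close> and pseudo-division by an element \<open>h\<close> of \<open>Q\<close> of
  minimal degree in \<open>x\<close> give \<open>c^(m+1) Q \<subseteq> h B\<close>, where \<open>c\<close> in \<open>R[[y]]\<close> is the leading coefficient
  of \<open>h\<close>, and primes of \<open>R[[y]]\<close> stay prime in \<open>B\<close>.

  For general \<open>a\<close>, suppose that \<open>B/(a, b)\<close> has \<open>y\<close>-torsion only up to powers of \<open>x\<close>. Then the image
  of \<open>Q\<close> in \<open>B/yB = A\<close> is, up to powers of \<open>x\<close>, the colon ideal \<open>(a(x, 0) : b(x, 0))\<close>, which is
  principal as \<open>A\<close> is factorial; Nakayama's lemma yields \<open>e Q \<subseteq> g B\<close> with \<open>e(x, 0) = x^k\<close>.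
  The torsion condition need not hold for \<open>y\<close>, but it holds for some \<open>y - x^(n+1)\<close> in place of \<open>y\<close>,
  which is turned into \<open>y\<close> by a translation automorphism of \<open>B\<close>.
\<close>

section \<open>Ideals and primes in commutative rings\<close>

interpretation ring_ideal: Modules.module "(*) :: 'a :: comm_ring_1 \<Rightarrow> 'a \<Rightarrow> 'a"
  by unfold_locales (simp_all add: algebra_simps)

declare ring_ideal.scale_scale [simp del] \<comment> \<open>loops together with \<open>mult.assoc\<close>\<close>

text \<open>A predicate on types rather than the class \<open>idom\<close>, because being a domain
  is only derived from the factoriality hypothesis; \<open>comm_ring_1\<close> provides 0 \<noteq>
  1.\<close>

definition int_dom :: "'a :: comm_ring_1 itself \<Rightarrow> bool"
  where "int_dom _ \<longleftrightarrow> (\<forall>a b :: 'a. a * b = 0 \<longrightarrow> a = 0 \<or> b = 0)"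

definition noetherian :: "'a :: comm_ring_1 itself \<Rightarrow> bool"
  where "noetherian _ \<longleftrightarrow>
    (\<forall>I :: 'a set. ring_ideal.subspace I \<longrightarrow> (\<exists>F. finite F \<and> I = ring_ideal.span F))"

lemma int_domD:
  fixes a b :: "'a :: comm_ring_1"
  assumes "int_dom TYPE('a)" "a * b = 0"
  shows "a = 0 \<or> b = 0"
  using assms unfolding int_dom_def by blast

lemma int_dom_mult_cancel:
  fixes a b c :: "'a :: comm_ring_1"
  assumes "int_dom TYPE('a)" "c \<noteq> 0" "c * a = c * b"
  shows "a = b"
proof -
  have "c * (a - b) = 0"
    using assms(3) by (simp add: algebra_simps)
  then show ?thesis
    using int_domD[OF assms(1)] assms(2) by fastforce
qed

section \<open>Noetherian rings and prime colon ideals\<close>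

lemma noetherianD:
  fixes I :: "'a :: comm_ring_1 set"
  assumes "noetherian TYPE('a)" "ring_ideal.subspace I"
  obtains F where "finite F" "I = ring_ideal.span F"
  using assms unfolding noetherian_def by blast

text \<open>The union of the chain is an ideal, and its finitely many generators already lie in one
  \<open>I N\<close>.\<close>

lemma noetherian_chain:
  fixes I :: "nat \<Rightarrow> 'a :: comm_ring_1 set"
  assumes noeth: "noetherian TYPE('a)"
    and ideal: "\<And>n. ring_ideal.subspace (I n)"
    and incr: "\<And>n. I n \<subseteq> I (Suc n)"
  shows "\<exists>N. \<forall>n\<ge>N. I n = I N"
proof -
  have mono: "I m \<subseteq> I n" if "m \<le> n" for m n
    using incr that by (rule lift_Suc_mono_le)
  have "ring_ideal.subspace (\<Union>n. I n)"
  proof (rule ring_ideal.subspaceI)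
    show "0 \<in> (\<Union>n. I n)"
      using ring_ideal.subspace_0[OF ideal] by blast
    show "x + y \<in> (\<Union>n. I n)" if xy: "x \<in> (\<Union>n. I n)" "y \<in> (\<Union>n. I n)" for x y
    proof -
      obtain m n where "x \<in> I m" "y \<in> I n" using xy by blast
      then have "x \<in> I (max m n)" "y \<in> I (max m n)"
        using mono[of m "max m n"] mono[of n "max m n"] by auto
      then show ?thesis
        using ring_ideal.subspace_add[OF ideal] by blast
    qed
    show "c * x \<in> (\<Union>n. I n)" if "x \<in> (\<Union>n. I n)" for c x
      using that ring_ideal.subspace_scale[OF ideal] by blast
  qed
  then obtain F where F: "finite F" "(\<Union>n. I n) = ring_ideal.span F"
    using noetherianD[OF noeth] by blast
  have "\<exists>N. F' \<subseteq> I N" if "finite F'" "F' \<subseteq> (\<Union>n. I n)" for F'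
    using that
  proof (induction F' rule: finite_induct)
    case (insert x F')
    then obtain m n where "x \<in> I m" "F' \<subseteq> I n" by blast
    then have "insert x F' \<subseteq> I (max m n)"
      using mono[of m "max m n"] mono[of n "max m n"] by auto
    then show ?case by blast
  qed auto
  then obtain N where N: "F \<subseteq> I N"
    using F ring_ideal.span_superset by metis
  have "(\<Union>n. I n) \<subseteq> I N"
    unfolding F(2) by (rule ring_ideal.span_minimal[OF N ideal])
  then show ?thesis
    using mono by blast
qed

text \<open>Otherwise iterated choice of a strictly larger ideal would give an ascending chain that
  never becomes stationary.\<close>

lemma noetherian_maximal:
  fixes I :: "'b \<Rightarrow> 'a :: comm_ring_1 set"
  assumes noeth: "noetherian TYPE('a)"
    and ideal: "\<And>b. ring_ideal.subspace (I b)"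
    and "P b0"
  shows "\<exists>b. P b \<and> (\<forall>c. P c \<longrightarrow> I b \<subseteq> I c \<longrightarrow> I c = I b)"
proof (rule ccontr)
  assume "\<not> ?thesis"
  then have "\<exists>c. P c \<and> I b \<subset> I c" if "P b" for b
    using that by blast
  then obtain nxt where nxt: "\<And>b. P b \<Longrightarrow> P (nxt b) \<and> I b \<subset> I (nxt b)"
    by metis
  define f where "f n = (nxt ^^ n) b0" for n
  have P: "P (f n)" for n
    by (induction n) (auto simp: f_def \<open>P b0\<close> nxt)
  have strict: "I (f n) \<subset> I (f (Suc n))" for n
    using nxt[OF P[of n]] by (simp add: f_def)
  have "\<exists>N. \<forall>n\<ge>N. I (f n) = I (f N)"
    by (rule noetherian_chain[OF noeth ideal]) (use strict in blast)
  then obtain N where "\<And>n. n \<ge> N \<Longrightarrow> I (f n) = I (f N)" by blast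
  then show False
    using strict[of N] by (metis le_SucI order.refl psubset_eq)
qed

text \<open>Maximality among the proper ideals (a : b) forces primality: if \<open>y * b\<close> is
  not in (a), then (a : b) is contained in (a : yb), hence equal to it, and x lies in the
  latter.\<close>

lemma exists_prime_colon:
  fixes a :: "'a :: comm_ring_1"
  assumes "noetherian TYPE('a)" "\<not> a dvd 1"
  obtains b where "\<not> a dvd b" "\<And>x y. a dvd x * y * b \<Longrightarrow> a dvd x * b \<or> a dvd y * b"
proof -
  define colon where "colon b = {q. a dvd q * b}" for b
  have sub: "ring_ideal.subspace (colon b)" for b
    by (rule ring_ideal.subspaceI)
      (simp_all add: colon_def distrib_right dvd_add mult.assoc dvd_mult)
  have "\<exists>b. \<not> a dvd b \<and> (\<forall>c. \<not> a dvd c \<longrightarrow> colon b \<subseteq> colon c \<longrightarrow> colon c = colon b)"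
    by (rule noetherian_maximal[OF assms(1) sub, of "\<lambda>b. \<not> a dvd b", OF assms(2)])
  then obtain b where b: "\<not> a dvd b"
      "\<And>c. \<not> a dvd c \<Longrightarrow> colon b \<subseteq> colon c \<Longrightarrow> colon c = colon b"
    by auto
  have "a dvd x * b \<or> a dvd y * b" if xy: "a dvd x * y * b" for x y
  proof (rule disjCI)
    assume y: "\<not> a dvd y * b"
    have "colon b \<subseteq> colon (y * b)"
      unfolding colon_def by (auto simp: mult.left_commute[of _ y b] intro: dvd_mult)
    then have "colon (y * b) = colon b"
      using b(2) y by blast
    moreover have "x \<in> colon (y * b)"
      using xy by (simp add: colon_def mult.assoc)
    ultimately show "a dvd x * b" by (simp add: colon_def)
  qed
  then show ?thesis using b(1) that by blast
qed

text \<open>The base case admits every unit, so factorizations up to associates qualify; induction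
  on the predicate is induction on the number of prime factors.\<close>

inductive prime_product :: "'a :: comm_ring_1 \<Rightarrow> bool" where
  unit: "u dvd 1 \<Longrightarrow> prime_product u"
| mult: "prime_elem p \<Longrightarrow> prime_product s \<Longrightarrow> prime_product (p * s)"

lemma prime_product_mult:
  assumes "prime_product s" "prime_product t"
  shows "prime_product (s * t)"
  using assms
proof (induction s rule: prime_product.induct)
  case (unit u)
  from unit(2,1) show ?case
  proof (induction t rule: prime_product.induct)
    case (unit t)
    then show ?case using mult_dvd_mono[of u 1 t 1] by (auto intro: prime_product.unit)
  next
    case (mult p s)
    then have "prime_product (p * (u * s))" by (auto intro: prime_product.mult)
    then show ?case by (simp only: mult.left_commute)
  qed
next
  case (mult p s)
  then have "prime_product (p * (s * t))" by (auto intro: prime_product.mult)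
  then show ?case by (simp only: mult.assoc)
qed

lemma prime_product_power: "prime_product s \<Longrightarrow> prime_product (s ^ n)"
  by (induction n) (auto intro: prime_product.unit prime_product_mult)

lemma prime_elem_associated:
  fixes p u :: "'a :: comm_ring_1"
  assumes "prime_elem p" "u dvd 1"
  shows "prime_elem (p * u)"
proof -
  obtain v where v: "u * v = 1" using assms(2) by (metis dvdE)
  have iff: "p * u dvd x \<longleftrightarrow> p dvd x" for x
  proof
    assume "p dvd x"
    then obtain k where "x = p * k" by (rule dvdE)
    also have "p * k = p * (u * v) * k" using v by simp
    also have "\<dots> = p * u * (v * k)" by (simp only: mult.assoc)
    finally have "x = p * u * (v * k)" .
    then show "p * u dvd x" by (metis dvd_triv_left)
  qed (rule dvd_mult_left)
  have "p * u \<noteq> 0"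
  proof
    assume "p * u = 0"
    then have "p * (u * v) = 0" by (simp add: mult.assoc[symmetric])
    then show False using v assms(1) by simp
  qed
  then show ?thesis
    using assms(1) by (simp add: prime_elem_def iff)
qed

text \<open>Write p b = a c. If p divided c, cancelling p would put b into (a); so p divides a, and
  irreducibility makes a associated to p.\<close>

lemma prime_elem_of_prime_in_colon:
  fixes a b p :: "'a :: comm_ring_1"
  assumes dom: "int_dom TYPE('a)" and irr: "comm_semiring_1_class.irreducible a"
    and "\<not> a dvd b" and p: "prime_elem p" "a dvd p * b"
  shows "prime_elem a"
proof -
  obtain c where c: "p * b = a * c" using p(2) by (rule dvdE)
  have "p dvd a \<or> p dvd c"
    using p(1) c prime_elem_dvd_multD dvd_triv_left by metis
  moreover have "\<not> p dvd c"
  proof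
    assume "p dvd c"
    then obtain c' where "c = p * c'" by (rule dvdE)
    then have "p * b = p * (a * c')" using c by (simp add: mult.left_commute)
    then have "b = a * c'"
      using int_dom_mult_cancel[OF dom] prime_elem_not_zeroI[OF p(1)] by blast
    then show False using \<open>\<not> a dvd b\<close> by simp
  qed
  ultimately obtain d where d: "a = p * d" by (auto elim: dvdE)
  then have "d dvd 1"
    using irr p(1) by (metis comm_semiring_1_class.irreducible_def prime_elem_not_unit)
  then show ?thesis using prime_elem_associated[OF p(1)] d by simp
qed

text \<open>Each prime factor of \<open>s\<close> divides \<open>g\<close> or can be dropped from \<open>s\<close>, so in the end \<open>g\<close>
  generates the colon ideal \<open>(a : b)\<close>.\<close>

lemma prime_elem_of_colon:
  fixes a b s g :: "'a :: comm_ring_1"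
  assumes dom: "int_dom TYPE('a)" and irr: "comm_semiring_1_class.irreducible a"
    and nb: "\<not> a dvd b" and prime: "\<And>x y. a dvd x * y * b \<Longrightarrow> a dvd x * b \<or> a dvd y * b"
    and "prime_product s" and "a dvd g * b" "\<And>q. a dvd q * b \<Longrightarrow> g dvd s * q"
  shows "prime_elem a"
  using assms(5-7)
proof (induction s arbitrary: g rule: prime_product.induct)
  case (unit u)
  obtain v where v: "u * v = 1" using unit(1) by (metis dvdE)
  have g: "g dvd q" if "a dvd q * b" for q
  proof -
    have "g dvd v * (u * q)" using unit(3)[OF that] by (rule dvd_mult)
    moreover have "v * (u * q) = q"
      using v by (metis mult.assoc mult.commute mult.left_neutral)
    ultimately show ?thesis by simp
  qed
  then obtain c where c: "a = g * c" by (meson dvd_triv_left dvdE)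
  \<comment> \<open>Now g generates (a : b). It is no unit since b is not in (a), so irreducibility
    makes a and g associated, and a inherits primality from (a : b).\<close>
  have "\<not> g dvd 1"
  proof
    assume "g dvd 1"
    then obtain h where h: "g * h = 1" by (metis dvdE)
    have "a dvd h * (g * b)" using unit(2) by (rule dvd_mult)
    moreover have "h * (g * b) = b"
      using h by (metis mult.assoc mult.commute mult.left_neutral)
    ultimately show False using nb by simp
  qed
  then have "c dvd 1"
    using irr c by (metis comm_semiring_1_class.irreducible_def)
  then obtain d where d: "c * d = 1" by (metis dvdE)
  have "a dvd x" if gx: "g dvd x" for x
  proof -
    obtain k where "x = g * k" using gx by (rule dvdE)
    also have "g * k = g * (c * d) * k" using d by simp
    also have "\<dots> = a * (d * k)" unfolding c by (simp only: mult.assoc)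
    finally have "x = a * (d * k)" .
    then show ?thesis by simp
  qed
  show ?case
  proof (rule prime_elemI)
    show "a \<noteq> 0" "\<not> a dvd 1"
      using irr by (simp_all add: comm_semiring_1_class.irreducible_def)
    show "a dvd x \<or> a dvd y" if "a dvd x * y" for x y
    proof -
      have "a dvd x * y * b" using that by (rule dvd_mult2)
      then have "g dvd x \<or> g dvd y" using prime g by blast
      then show ?thesis using \<open>\<And>x. g dvd x \<Longrightarrow> a dvd x\<close> by blast
    qed
  qed
next
  case (mult p s)
  note p0 = prime_elem_not_zeroI[OF mult.hyps(1)]
  show ?case
  proof (cases "a dvd p * b")
    case True
    then show ?thesis
      using prime_elem_of_prime_in_colon[OF dom irr nb mult.hyps(1)] by blast
  next
    case pQ: False
    show ?thesis
    proof (cases "p dvd g")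
      case True
      then obtain g' where g': "g = p * g'" by (rule dvdE)
      show ?thesis
      proof (rule mult.IH)
        \<comment> \<open>The ideal (a : b) is prime and does not contain p, so it contains the
          cofactor g' of p in g.\<close>
        show "a dvd g' * b"
          using prime mult.prems(1) pQ unfolding g' by blast
        show "g' dvd s * q" if q: "a dvd q * b" for q
        proof -
          obtain k where "p * s * q = g * k" using mult.prems(2)[OF q] by (rule dvdE)
          then have "p * (s * q) = p * (g' * k)" unfolding g' by (simp add: mult.assoc)
          then have "s * q = g' * k" by (rule int_dom_mult_cancel[OF dom p0])
          then show ?thesis by simp
        qed
      qed
    next
      case False
      show ?thesis
      proof (rule mult.IH[OF mult.prems(1)])
        show "g dvd s * q" if q: "a dvd q * b" for q
        proof -
          obtain k where k: "p * s * q = g * k" using mult.prems(2)[OF q] by (rule dvdE)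
          then have "p dvd g * k" by (metis dvd_triv_left mult.assoc)
          then have "p dvd k" using False mult.hyps(1) prime_elem_dvd_multD by blast
          then obtain k' where "k = p * k'" by (rule dvdE)
          then have "p * (s * q) = p * (g * k')" using k by (simp add: algebra_simps)
          then have "s * q = g * k'" by (rule int_dom_mult_cancel[OF dom p0])
          then show ?thesis by simp
        qed
      qed
    qed
  qed
qed

section \<open>Power series over Noetherian domains\<close>

lemma int_dom_fps:
  assumes "int_dom TYPE('a :: comm_ring_1)"
  shows "int_dom TYPE('a fps)"
  unfolding int_dom_def
proof (intro allI impI, rule ccontr)
  fix f g :: "'a fps"
  assume "f * g = 0" and "\<not> (f = 0 \<or> g = 0)"
  then have "f $ subdegree f \<noteq> 0" "g $ subdegree g \<noteq> 0" by simp_all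
  moreover have "f $ subdegree f * g $ subdegree g = 0"
    using nth_subdegree_mult[of f g] \<open>f * g = 0\<close> by simp
  ultimately show False using int_domD[OF assms] by blast
qed

lemma int_dom_of_fps:
  assumes "int_dom TYPE('a :: comm_ring_1 fps)"
  shows "int_dom TYPE('a)"
  unfolding int_dom_def
proof (intro allI impI)
  fix a b :: 'a
  assume "a * b = 0"
  then have "fps_const a * fps_const b = 0" by simp
  then show "a = 0 \<or> b = 0" using int_domD[OF assms] by fastforce
qed

lemma fps_dvd_1_iff:
  fixes f :: "'a :: comm_ring_1 fps"
  shows "f dvd 1 \<longleftrightarrow> f $ 0 dvd 1"
proof
  assume "f dvd 1"
  then obtain g where "1 = f * g" by (rule dvdE)
  then have "1 = f $ 0 * g $ 0" by (metis fps_mult_nth_0 fps_one_nth)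
  then show "f $ 0 dvd 1" by (rule dvdI)
next
  assume "f $ 0 dvd 1"
  then obtain y where "1 = f $ 0 * y" by (rule dvdE)
  then show "f dvd 1" using fps_right_inverse[of f y] by (metis dvd_triv_left)
qed

lemma fps_const_dvd_iff:
  fixes f :: "'a :: comm_ring_1 fps"
  shows "fps_const p dvd f \<longleftrightarrow> (\<forall>n. p dvd f $ n)"
proof
  assume "\<forall>n. p dvd f $ n"
  then obtain k where "\<And>n. f $ n = p * k n" unfolding dvd_def by metis
  then have "f = fps_const p * Abs_fps k" by (simp add: fps_eq_iff)
  then show "fps_const p dvd f" by simp
qed (auto elim!: dvdE)

lemma fps_X_dvd_iff:
  fixes f :: "'a :: comm_ring_1 fps"
  shows "fps_X dvd f \<longleftrightarrow> f $ 0 = 0"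
proof
  assume "f $ 0 = 0"
  then have "f = fps_X * fps_shift 1 f" by (auto simp: fps_eq_iff)
  then show "fps_X dvd f" by (metis dvd_triv_left)
qed (auto elim!: dvdE)

lemma prime_elem_fps_X:
  assumes "int_dom TYPE('a :: comm_ring_1)"
  shows "prime_elem (fps_X :: 'a fps)"
  by (rule prime_elemI) (use int_domD[OF assms] in \<open>auto simp: fps_X_dvd_iff fps_dvd_1_iff\<close>)

text \<open>Gauss's argument: if i and j are the first indices at which p fails to divide f and g,
  then modulo p the coefficient of the product at i + j is \<open>f $ i * g $ j\<close>.\<close>

lemma prime_elem_fps_const:
  fixes p :: "'a :: comm_ring_1"
  assumes p: "prime_elem p"
  shows "prime_elem (fps_const p)"
proof (rule prime_elemI)
  show "fps_const p \<noteq> 0" using p by auto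
  show "\<not> fps_const p dvd 1" using p by (simp add: fps_dvd_1_iff prime_elem_def)
  fix f g :: "'a fps"
  assume fg: "fps_const p dvd f * g"
  show "fps_const p dvd f \<or> fps_const p dvd g"
  proof (rule ccontr)
    assume neg: "\<not> ?thesis"
    define i where "i = (LEAST n. \<not> p dvd f $ n)"
    define j where "j = (LEAST n. \<not> p dvd g $ n)"
    have i: "\<not> p dvd f $ i" "\<And>k. k < i \<Longrightarrow> p dvd f $ k"
      using neg LeastI_ex[of "\<lambda>n. \<not> p dvd f $ n"] not_less_Least
      unfolding i_def fps_const_dvd_iff by blast+
    have j: "\<not> p dvd g $ j" "\<And>k. k < j \<Longrightarrow> p dvd g $ k"
      using neg LeastI_ex[of "\<lambda>n. \<not> p dvd g $ n"] not_less_Least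
      unfolding j_def fps_const_dvd_iff by blast+
    have "(f * g) $ (i + j) = f $ i * g $ j + (\<Sum>k\<in>{0..i+j}-{i}. f $ k * g $ (i + j - k))"
      by (simp add: fps_mult_nth sum.remove[of _ i])
    moreover have "p dvd (\<Sum>k\<in>{0..i+j}-{i}. f $ k * g $ (i + j - k))"
    proof (rule dvd_sum)
      fix k assume "k \<in> {0..i+j}-{i}"
      then have "k < i \<or> i + j - k < j" by auto
      then show "p dvd f $ k * g $ (i + j - k)" using i(2) j(2) by auto
    qed
    moreover have "p dvd (f * g) $ (i + j)" using fg fps_const_dvd_iff by blast
    ultimately have "p dvd f $ i * g $ j" by (simp add: dvd_add_left_iff)
    then show False using p i(1) j(1) prime_elem_dvd_multD by blast
  qed
qed

section \<open>Exchange of the two variables and ring automorphisms\<close>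

definition fps_swap :: "'a :: comm_ring_1 fps fps \<Rightarrow> 'a fps fps"
  where "fps_swap f = Abs_fps (\<lambda>i. Abs_fps (\<lambda>j. f $ j $ i))"

lemma fps_swap_nth [simp]: "fps_swap f $ i $ j = f $ j $ i"
  by (simp add: fps_swap_def)

lemma fps_swap_swap [simp]: "fps_swap (fps_swap f) = f"
  by (simp add: fps_eq_iff)

lemma fps_swap_mult: "fps_swap (f * g) = fps_swap f * fps_swap g"
proof (intro fps_ext)
  fix i j
  show "fps_swap (f * g) $ i $ j = (fps_swap f * fps_swap g) $ i $ j"
    unfolding fps_swap_nth fps_fps_ring_ops_nth(4) by (rule sum.swap)
qed

lemma fps_swap_add: "fps_swap (f + g) = fps_swap f + fps_swap g"
  by (simp add: fps_eq_iff)

text \<open>Instantiated by the exchange of variables and by translations, to transport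
  divisibility, irreducibility and primality.\<close>

locale ring_auto =
  fixes \<sigma> \<tau> :: "'a :: comm_ring_1 \<Rightarrow> 'a"
  assumes mult: "\<sigma> (x * y) = \<sigma> x * \<sigma> y" and add: "\<sigma> (x + y) = \<sigma> x + \<sigma> y"
    and inv1: "\<tau> (\<sigma> x) = x" and inv2: "\<sigma> (\<tau> x) = x"
begin

lemma inj: "\<sigma> x = \<sigma> y \<longleftrightarrow> x = y"
  using inv1 by metis

lemma zero: "\<sigma> 0 = 0"
  using add[of 0 0] by simp

lemma one: "\<sigma> 1 = 1"
  using mult[of 1 "\<tau> 1"] by (simp add: inv2)

lemma dvd_iff: "\<sigma> x dvd \<sigma> y \<longleftrightarrow> x dvd y"
  unfolding dvd_def by (metis mult inv1 inv2)

lemma dvd_iff': "\<sigma> x dvd y \<longleftrightarrow> x dvd \<tau> y"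
  using dvd_iff[of x "\<tau> y"] by (simp add: inv2)

lemma prime_elem_iff: "prime_elem (\<sigma> x) \<longleftrightarrow> prime_elem x"
proof -
  have "(\<forall>a b. \<sigma> x dvd a * b \<longrightarrow> \<sigma> x dvd a \<or> \<sigma> x dvd b) \<longleftrightarrow>
        (\<forall>a b. x dvd a * b \<longrightarrow> x dvd a \<or> x dvd b)"
    by (metis dvd_iff inv2 mult)
  then show ?thesis
    unfolding prime_elem_def using inj[of x 0] dvd_iff[of x 1] by (simp add: zero one)
qed

lemma irreducible_iff:
  "comm_semiring_1_class.irreducible (\<sigma> x) \<longleftrightarrow> comm_semiring_1_class.irreducible x"
proof -
  have unit: "\<sigma> a dvd 1 \<longleftrightarrow> a dvd 1" for a
    using dvd_iff[of a 1] by (simp add: one)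
  have "(\<forall>a b. \<sigma> x = a * b \<longrightarrow> a dvd 1 \<or> b dvd 1) \<longleftrightarrow>
        (\<forall>a b. \<sigma> x = \<sigma> a * \<sigma> b \<longrightarrow> \<sigma> a dvd 1 \<or> \<sigma> b dvd 1)"
    using inv2 by metis
  also have "\<dots> \<longleftrightarrow> (\<forall>a b. x = a * b \<longrightarrow> a dvd 1 \<or> b dvd 1)"
    unfolding mult[symmetric] inj unit ..
  finally have "(\<forall>a b. \<sigma> x = a * b \<longrightarrow> a dvd 1 \<or> b dvd 1) \<longleftrightarrow>
        (\<forall>a b. x = a * b \<longrightarrow> a dvd 1 \<or> b dvd 1)" .
  then show ?thesis
    unfolding comm_semiring_1_class.irreducible_def
    using inj[of x 0] dvd_iff[of x 1] by (simp add: zero one)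
qed

end

interpretation fps_swap: ring_auto fps_swap fps_swap
  by unfold_locales (simp_all add: fps_swap_mult fps_swap_add)

text \<open>Hilbert's basis theorem with lowest instead of highest coefficients: the ideals
  \<open>L n\<close> of lowest coefficients increase and become stationary at some N, and I is
  generated by lifts of generators of \<open>L 0\<close>, ..., \<open>L N\<close>.\<close>

lemma noetherian_fps:
  assumes noeth: "noetherian TYPE('a :: comm_ring_1)"
  shows "noetherian TYPE('a fps)"
  unfolding noetherian_def
proof (intro allI impI)
  fix I :: "'a fps set"
  assume I: "ring_ideal.subspace I"
  define ord where "ord n f \<longleftrightarrow> (\<forall>i<n. f $ i = 0)" for n and f :: "'a fps"
  define L where "L n = {f $ n | f. f \<in> I \<and> ord n f}" for n
  have ideal_L: "ring_ideal.subspace (L n)" for n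
  proof (rule ring_ideal.subspaceI)
    show "0 \<in> L n"
      unfolding L_def by (rule CollectI, rule exI[of _ 0])
        (simp add: ord_def ring_ideal.subspace_0[OF I])
    fix x y c
    assume x: "x \<in> L n"
    then obtain f where f: "f \<in> I" "ord n f" "x = f $ n" unfolding L_def by blast
    show "x + y \<in> L n" if y: "y \<in> L n"
    proof -
      obtain g where g: "g \<in> I" "ord n g" "y = g $ n" using y unfolding L_def by blast
      have "f + g \<in> I \<and> ord n (f + g) \<and> x + y = (f + g) $ n"
        using f g ring_ideal.subspace_add[OF I] by (simp add: ord_def)
      then show ?thesis unfolding L_def by blast
    qed
    have "fps_const c * f \<in> I \<and> ord n (fps_const c * f) \<and> c * x = (fps_const c * f) $ n"
      using f ring_ideal.subspace_scale[OF I] by (simp add: ord_def)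
    then show "c * x \<in> L n" unfolding L_def by blast
  qed
  have L_Suc: "L n \<subseteq> L (Suc n)" for n
  proof
    fix x assume "x \<in> L n"
    then obtain f where f: "f \<in> I" "ord n f" "x = f $ n" unfolding L_def by blast
    then have "fps_X * f \<in> I \<and> ord (Suc n) (fps_X * f) \<and> x = (fps_X * f) $ Suc n"
      using ring_ideal.subspace_scale[OF I] by (simp add: ord_def)
    then show "x \<in> L (Suc n)" unfolding L_def by blast
  qed
  obtain N where N: "\<And>n. n \<ge> N \<Longrightarrow> L n = L N"
    using noetherian_chain[OF noeth, of L, OF ideal_L L_Suc] by auto
  have "\<exists>G. finite G \<and> L n = ring_ideal.span G" for n
    using noeth ideal_L unfolding noetherian_def by blast
  then obtain G where G: "\<And>n. finite (G n)" "\<And>n. L n = ring_ideal.span (G n)" by metis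
  have "\<forall>c\<in>L n. \<exists>f. f \<in> I \<and> ord n f \<and> c = f $ n" for n
    unfolding L_def by blast
  then obtain l where l: "\<And>n c. c \<in> L n \<Longrightarrow> l n c \<in> I \<and> ord n (l n c) \<and> c = l n c $ n"
    by metis
  have GL: "c \<in> L n" if "c \<in> G n" for c n
    using that G(2) ring_ideal.span_base by blast
  define F where "F = (\<Union>n\<le>N. l n ` G n)"
  have F: "finite F" "F \<subseteq> I" unfolding F_def using G(1) l GL by auto
  have lF: "l n c \<in> ring_ideal.span F" if "n \<le> N" "c \<in> G n" for n c
    using that by (auto simp: F_def intro!: ring_ideal.span_base)
  \<comment> \<open>One reduction step: the lowest coefficient of f is a combination of generators
    of \<open>L m\<close>, and the lifts shifted by \<open>fps_X ^ (n - m)\<close> cancel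
    it.\<close>
  have sum_lead: "\<exists>r. ord (Suc n) (f - (\<Sum>c\<in>G m. fps_const (r c) * fps_X ^ (n - m) * l m c))"
    if "ord n f" and fn: "f $ n \<in> L m" and "m \<le> n" for f n m
  proof -
    obtain r where r: "f $ n = (\<Sum>c\<in>G m. r c * c)"
      using fn unfolding G(2) ring_ideal.span_finite[OF G(1)] by blast
    have nth: "(fps_const a * fps_X ^ (n - m) * l m c) $ i =
        (if i < n - m then 0 else a * l m c $ (i - (n - m)))" for a c i
      by (simp add: mult.assoc fps_X_power_mult_nth)
    have "ord (Suc n) (f - (\<Sum>c\<in>G m. fps_const (r c) * fps_X ^ (n - m) * l m c))"
      unfolding ord_def
    proof (intro allI impI)
      fix i assume "i < Suc n"
      then consider "i < n" | "i = n" by linarith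
      then show "(f - (\<Sum>c\<in>G m. fps_const (r c) * fps_X ^ (n - m) * l m c)) $ i = 0"
      proof cases
        case 1
        then have "i - (n - m) < m" if "\<not> i < n - m" using that \<open>m \<le> n\<close> by linarith
        then have "(fps_const a * fps_X ^ (n - m) * l m c) $ i = 0" if "c \<in> G m" for a c
          using l[OF GL[OF that]] unfolding nth by (simp add: ord_def)
        then show ?thesis using 1 \<open>ord n f\<close> by (simp add: fps_sum_nth ord_def)
      next
        case 2
        have "(fps_const (r c) * fps_X ^ (n - m) * l m c) $ i = r c * c" if "c \<in> G m" for c
          using l[OF GL[OF that]] 2 \<open>m \<le> n\<close> unfolding nth by simp
        then show ?thesis using 2 r by (simp add: fps_sum_nth)
      qed
    qed
    then show ?thesis by blast
  qed
  \<comment> \<open>Finitely many reductions raise the order to N.\<close>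
  have low: "\<exists>h\<in>ring_ideal.span F. ord N (f - h)" if "f \<in> I" for f
  proof -
    have "\<exists>h\<in>ring_ideal.span F. ord n (f - h)" if "n \<le> N" for n
      using that
    proof (induction n)
      case 0
      show ?case using ring_ideal.span_zero by (intro bexI[of _ 0]) (auto simp: ord_def)
    next
      case (Suc n)
      then obtain h where h: "h \<in> ring_ideal.span F" "ord n (f - h)" by auto
      have "h \<in> I" using h(1) ring_ideal.span_minimal[OF F(2) I] by blast
      then have "f - h \<in> I" using ring_ideal.subspace_diff[OF I \<open>f \<in> I\<close>] by blast
      then have "(f - h) $ n \<in> L n" using h(2) unfolding L_def by blast
      then obtain r where r: "ord (Suc n) (f - h - (\<Sum>c\<in>G n. fps_const (r c) * fps_X ^ (n - n) * l n c))"
        using sum_lead[OF h(2)] by blast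
      have "(\<Sum>c\<in>G n. fps_const (r c) * fps_X ^ (n - n) * l n c) \<in> ring_ideal.span F"
        using Suc.prems by (intro ring_ideal.span_sum ring_ideal.span_scale lF) auto
      then have "h + (\<Sum>c\<in>G n. fps_const (r c) * fps_X ^ (n - n) * l n c) \<in> ring_ideal.span F"
        using h(1) ring_ideal.span_add by blast
      then show ?case using r by (metis diff_diff_eq)
    qed
    then show ?thesis by blast
  qed
  have high: "f \<in> ring_ideal.span F" if f: "f \<in> I" "ord N f" for f
  proof -
    define good where "good n g r \<longleftrightarrow>
      ord (Suc (N + n)) (g - (\<Sum>c\<in>G N. fps_const (r c) * fps_X ^ n * l N c))" for n g r
    have good_ex: "\<exists>r. good n g r" if "g \<in> I \<and> ord (N + n) g" for n g
    proof -
      have "g $ (N + n) \<in> L (N + n)" using that unfolding L_def by blast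
      then show ?thesis
        using sum_lead[of "N + n" g N] N[of "N + n"] that by (simp add: good_def)
    qed
    define r where "r n g = (SOME r. good n g r)" for n g
    have r: "ord (Suc (N + n)) (g - (\<Sum>c\<in>G N. fps_const (r n g c) * fps_X ^ n * l N c))"
      if "g \<in> I \<and> ord (N + n) g" for n g
      using someI_ex[OF good_ex[OF that]] by (simp add: r_def good_def)
    \<comment> \<open>From order N on only the lifts at level N are used; the remainders
      \<open>g n\<close> have order at least N + n.\<close>
    define g where "g = rec_nat f (\<lambda>n g. g - (\<Sum>c\<in>G N. fps_const (r n g c) * fps_X ^ n * l N c))"
    have g_Suc: "g (Suc n) = g n - (\<Sum>c\<in>G N. fps_const (r n (g n) c) * fps_X ^ n * l N c)" for n
      by (simp add: g_def)
    have g_inv: "g n \<in> I \<and> ord (N + n) (g n)" for n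
    proof (induction n)
      case 0
      then show ?case using f by (simp add: g_def)
    next
      case (Suc n)
      have "(\<Sum>c\<in>G N. fps_const (r n (g n) c) * fps_X ^ n * l N c) \<in> I"
        using l GL by (intro ring_ideal.subspace_sum[OF I] ring_ideal.subspace_scale[OF I]) auto
      then show ?case
        using Suc r[OF Suc] ring_ideal.subspace_diff[OF I] unfolding g_Suc by simp
    qed
    \<comment> \<open>The multipliers chosen at stage n become the n-th coefficients of the series
      \<open>q c\<close>, so the infinite reduction sums to a finite combination.\<close>
    define q where "q c = Abs_fps (\<lambda>n. r n (g n) c)" for c
    have g_eq: "f = g n + (\<Sum>c\<in>G N. (\<Sum>k<n. fps_const (q c $ k) * fps_X ^ k) * l N c)" for n
    proof (induction n)
      case (Suc n)
      have "g n = g (Suc n) + (\<Sum>c\<in>G N. fps_const (q c $ n) * fps_X ^ n * l N c)"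
        unfolding g_Suc by (simp add: q_def)
      then show ?case
        by (subst Suc) (simp add: distrib_right sum.distrib)
    qed (simp add: g_def)
    have "f = (\<Sum>c\<in>G N. q c * l N c)"
    proof (rule fps_ext)
      fix m
      \<comment> \<open>Only terms up to index m affect the coefficient at m, so the partial sums
        may be replaced by \<open>q c\<close>.\<close>
      have trunc: "(\<Sum>k<Suc m. fps_const (q c $ k) * fps_X ^ k) $ i = q c $ i" if "i \<le> m" for c i
      proof -
        have "(\<Sum>k<Suc m. fps_const (q c $ k) * fps_X ^ k) $ i = (\<Sum>k<Suc m. if i = k then q c $ k else 0)"
          unfolding fps_sum_nth by (intro sum.cong) auto
        then show ?thesis using that by (simp del: sum.lessThan_Suc)
      qed
      have "g (Suc m) $ m = 0" using g_inv[of "Suc m"] by (simp add: ord_def)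
      then have "f $ m = (\<Sum>c\<in>G N. ((\<Sum>k<Suc m. fps_const (q c $ k) * fps_X ^ k) * l N c) $ m)"
        using arg_cong[OF g_eq[of "Suc m"], of "\<lambda>f. f $ m"]
        by (simp add: fps_sum_nth[of _ "G N"] del: sum.lessThan_Suc)
      also have "\<dots> = (\<Sum>c\<in>G N. (q c * l N c) $ m)"
        by (intro sum.cong refl) (simp add: fps_mult_nth trunc del: sum.lessThan_Suc)
      finally show "f $ m = (\<Sum>c\<in>G N. q c * l N c) $ m" by (simp add: fps_sum_nth)
    qed
    then show ?thesis
      using lF by (auto intro!: ring_ideal.span_sum ring_ideal.span_scale)
  qed
  have "I \<subseteq> ring_ideal.span F"
  proof
    fix f assume "f \<in> I"
    then obtain h where h: "h \<in> ring_ideal.span F" "ord N (f - h)" using low by blast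
    have "h \<in> I" using h(1) ring_ideal.span_minimal[OF F(2) I] by blast
    then have "f - h \<in> ring_ideal.span F"
      using high ring_ideal.subspace_diff[OF I \<open>f \<in> I\<close>] h(2) by blast
    then show "f \<in> ring_ideal.span F"
      using ring_ideal.span_add[OF _ h(1), of "f - h"] by simp
  qed
  then show "\<exists>F. finite F \<and> I = ring_ideal.span F"
    using F ring_ideal.span_minimal[OF F(2) I] by blast
qed

section \<open>Weierstrass division\<close>

lemma dvd_1_mult_dvd:
  fixes u :: "'a :: comm_ring_1"
  assumes "u dvd 1" "g dvd u * x"
  shows "g dvd x"
proof -
  obtain v where v: "1 = u * v" using assms(1) by (rule dvdE)
  have "g dvd v * (u * x)" using assms(2) by (rule dvd_mult)
  also have "v * (u * x) = u * v * x" by (simp only: ac_simps)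
  finally show ?thesis by (simp add: v[symmetric])
qed

lemma prime_product_fps_const: "prime_product c \<Longrightarrow> prime_product (fps_const c)"
proof (induction c rule: prime_product.induct)
  case (unit u)
  then show ?case by (intro prime_product.unit) (simp add: fps_dvd_1_iff)
next
  case (mult p s)
  then show ?case
    using prime_product.mult[OF prime_elem_fps_const] by (metis fps_const_mult)
qed

text \<open>Coefficient of y^n of the quotient q in f = q e + r, where \<open>e $ 0\<close> is x^m u
  and v is meant as the inverse of u. Comparison at y^n gives q_n x^m u = g - r_n with g known from
  earlier coefficients; \<open>fps_shift m\<close> removes r_n, of degree below m in x, and divides
  by x^m.\<close>

fun weierstrass_quotient ::
    "'a :: comm_ring_1 fps \<Rightarrow> nat \<Rightarrow> 'a fps fps \<Rightarrow> 'a fps fps \<Rightarrow> nat \<Rightarrow> 'a fps" where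
  "weierstrass_quotient v m e f n =
    v * fps_shift m (f $ n - (\<Sum>i<n. weierstrass_quotient v m e f i * e $ (n - i)))"

declare weierstrass_quotient.simps [simp del]

text \<open>By construction the coefficient of y^n in \<open>f - q * e\<close> is
  \<open>g - fps_X ^ m * fps_shift m g\<close>, the part of g of degree below m in x.\<close>

lemma weierstrass_division:
  fixes e f :: "'a :: comm_ring_1 fps fps"
  assumes e: "e $ 0 = fps_X ^ m * u" "u dvd 1"
  shows "\<exists>q r. f = q * e + r \<and> (\<forall>n i. m \<le> i \<longrightarrow> r $ n $ i = 0)"
proof -
  obtain v where v: "1 = u * v" using e(2) by (rule dvdE)
  define q where "q = Abs_fps (weierstrass_quotient v m e f)"
  have "(f - q * e) $ n $ i = 0" if "m \<le> i" for n i
  proof -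
    define g where "g = f $ n - (\<Sum>i<n. q $ i * e $ (n - i))"
    have "q $ n = v * fps_shift m g"
      by (simp add: q_def g_def weierstrass_quotient.simps[of v m e f n])
    then have "q $ n * e $ 0 = u * v * (fps_X ^ m * fps_shift m g)"
      by (simp add: e(1) ac_simps)
    then have qe: "q $ n * e $ 0 = fps_X ^ m * fps_shift m g"
      unfolding v[symmetric] by simp
    have "(q * e) $ n = (\<Sum>i<n. q $ i * e $ (n - i)) + q $ n * e $ 0"
      by (simp add: fps_mult_nth atLeast0AtMost lessThan_Suc_atMost[symmetric])
    then have "(f - q * e) $ n = g - fps_X ^ m * fps_shift m g"
      unfolding qe by (simp add: g_def)
    then show ?thesis using that by (simp add: fps_X_power_mult_nth)
  qed
  then show ?thesis by (intro exI[of _ q] exI[of _ "f - q * e"]) auto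
qed

text \<open>Divide x^m by e: x^m = v e + r. At y = 0 the coefficients of degree at least m show that
  \<open>v $ 0\<close> is inverse to u, so v is a unit and v e = x^m - r has degree at most m in
  x.\<close>

lemma weierstrass_preparation:
  fixes e :: "'a :: comm_ring_1 fps fps"
  assumes e: "e $ 0 = fps_X ^ m * u" "u dvd 1"
  shows "\<exists>v. v dvd 1 \<and> (\<forall>n i. m < i \<longrightarrow> (v * e) $ n $ i = 0)"
proof -
  obtain v r where vr: "fps_const (fps_X ^ m) = v * e + r" "\<And>n i. m \<le> i \<Longrightarrow> r $ n $ i = 0"
    using weierstrass_division[OF e, of "fps_const (fps_X ^ m)"] by blast
  have "(fps_X ^ m :: 'a fps) = (v * e + r) $ 0" unfolding vr(1)[symmetric] by simp
  also have "\<dots> = fps_X ^ m * (v $ 0 * u) + r $ 0" by (simp add: e(1) ac_simps)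
  finally have eq: "fps_X ^ m = fps_X ^ m * (v $ 0 * u) + r $ 0" .
  have "v $ 0 * u = 1"
  proof (rule fps_ext)
    fix i
    have "(fps_X ^ m :: 'a fps) $ (i + m) = (fps_X ^ m * (v $ 0 * u) + r $ 0) $ (i + m)"
      using eq by simp
    then show "(v $ 0 * u) $ i = 1 $ i"
      using vr(2)[of "i + m" 0] by (simp add: fps_X_power_mult_nth split: if_splits)
  qed
  then have "v dvd 1" unfolding fps_dvd_1_iff[of v] by (metis dvd_triv_left)
  moreover have "(v * e) $ n $ i = 0" if "m < i" for n i
  proof -
    have "v * e = fps_const (fps_X ^ m) - r" using vr(1) by (simp add: algebra_simps)
    then show ?thesis using vr(2)[of i n] that by simp
  qed
  ultimately show ?thesis by blast
qed

text \<open>Used with R[[y]] for \<open>'a\<close> and x for \<open>fps_X\<close>; the criterion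
  \<open>prime_elem_of_colon\<close> is applied to an h of least degree in (e : b) and a power of
  its leading coefficient.\<close>

lemma prime_elem_of_weierstrass:
  fixes e :: "'a :: comm_ring_1 fps"
  assumes dom: "int_dom TYPE('a)" and noeth: "noetherian TYPE('a)"
    and ufd: "\<And>c :: 'a. c \<noteq> 0 \<Longrightarrow> prime_product c"
    and irr: "comm_semiring_1_class.irreducible e"
    and division: "\<And>f. \<exists>q r. f = q * e + r \<and> (\<forall>i\<ge>m. r $ i = 0)"
    and v: "v dvd 1" "\<And>i. m < i \<Longrightarrow> (v * e) $ i = 0"
  shows "prime_elem e"
proof -
  have "e \<noteq> 0" "\<not> e dvd 1"
    using irr by (simp_all add: comm_semiring_1_class.irreducible_def)
  obtain b where b: "\<not> e dvd b" "\<And>x y. e dvd x * y * b \<Longrightarrow> e dvd x * b \<or> e dvd y * b"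
    using exists_prime_colon[OF noetherian_fps[OF noeth] \<open>\<not> e dvd 1\<close>] by metis
  define Q where "Q = {q. e dvd q * b}"
  have Q_diff: "f - g \<in> Q" if "f \<in> Q" "g \<in> Q" for f g
    using that dvd_diff by (auto simp: Q_def left_diff_distrib)
  have Q_mult: "f * g \<in> Q" if "g \<in> Q" for f g
    using that dvd_mult by (auto simp: Q_def mult.assoc)
  have e_Q: "e \<in> Q" by (simp add: Q_def)
  define low where "low k h \<longleftrightarrow> h \<in> Q \<and> h \<noteq> 0 \<and> (\<forall>i\<ge>k. h $ i = 0)" for k h
  \<comment> \<open>The Weierstrass polynomial v e shows that Q contains nonzero polynomials in
    \<open>fps_X\<close>.\<close>
  have "v * e \<noteq> 0"
    using dvd_1_mult_dvd[OF v(1), of 0 e] \<open>e \<noteq> 0\<close> by auto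
  then have "low (Suc m) (v * e)"
    using v(2) Q_mult[OF e_Q] by (simp add: low_def)
  then have ex: "\<exists>k h. low k h" by blast
  \<comment> \<open>This k exceeds the least degree j of a nonzero polynomial in Q by one.\<close>
  define k where "k = (LEAST k. \<exists>h. low k h)"
  obtain h where h: "low k h" using LeastI_ex[OF ex] unfolding k_def by blast
  have min: "\<not> low j f" if "j < k" for j f
    using not_less_Least[of j "\<lambda>k. \<exists>h. low k h"] that unfolding k_def by blast
  have "k \<noteq> 0"
  proof
    assume "k = 0"
    then have "h = 0" using h by (simp add: low_def fps_eq_iff)
    then show False using h by (simp add: low_def)
  qed
  then obtain j where j: "k = Suc j" using not0_implies_Suc by blast
  define c where "c = h $ j"
  have "c \<noteq> 0"
  proof
    assume "c = 0"
    then have "low j h" using h unfolding low_def j c_def by (metis Suc_leI le_neq_implies_less)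
    then show False using min[of j] j by simp
  qed
  \<comment> \<open>Pseudo-division: multiplying by c and subtracting a multiple of h lowers the
    degree bound by one within Q; below degree j only 0 remains by minimality.\<close>
  have pseudo: "h dvd fps_const c ^ l * f" if "f \<in> Q" "\<forall>i\<ge>l. f $ i = 0" for l f
    using that
  proof (induction l arbitrary: f)
    case 0
    then have "f = 0" by (simp add: fps_eq_iff)
    then show ?case by simp
  next
    case (Suc l)
    show ?case
    proof (cases "Suc l \<le> j")
      case True
      then have "f = 0" using Suc.prems min[of "Suc l" f] j by (auto simp: low_def)
      then show ?thesis by simp
    next
      case False
      define f' where "f' = fps_const c * f - fps_const (f $ l) * fps_X ^ (l - j) * h"
      have "f' \<in> Q" unfolding f'_def using Suc.prems(1) h by (intro Q_diff Q_mult) (auto simp: low_def)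
      moreover have "\<forall>i\<ge>l. f' $ i = 0"
      proof (intro allI impI)
        fix i assume "l \<le> i"
        consider "i = l" | "l < i" using \<open>l \<le> i\<close> by linarith
        then show "f' $ i = 0"
        proof cases
          case 1
          then show ?thesis
            using False by (simp add: f'_def mult.assoc fps_X_power_mult_nth c_def)
        next
          case 2
          then have "h $ (i - (l - j)) = 0" using h j False by (simp add: low_def)
          then show ?thesis
            using 2 Suc.prems(2) by (simp add: f'_def mult.assoc fps_X_power_mult_nth)
        qed
      qed
      ultimately have "h dvd fps_const c ^ l * f'" by (rule Suc.IH)
      moreover have "fps_const c ^ Suc l * f =
          fps_const c ^ l * f' + fps_const c ^ l * fps_const (f $ l) * fps_X ^ (l - j) * h"
        unfolding f'_def by (simp only: power_Suc right_diff_distrib ac_simps) simp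
      ultimately show ?thesis by (simp add: dvd_add)
    qed
  qed
  \<comment> \<open>One factor c more than the remainders r require, because v e may have degree
    m.\<close>
  define s where "s = fps_const c ^ Suc m"
  have "h dvd s * (v * e)"
    unfolding s_def using v(2) Q_mult[OF e_Q] by (intro pseudo) auto
  then have "h dvd v * (s * e)" by (simp only: ac_simps)
  then have he: "h dvd s * e" by (rule dvd_1_mult_dvd[OF v(1)])
  show ?thesis
  proof (rule prime_elem_of_colon[OF int_dom_fps[OF dom] irr b])
    show "prime_product s"
      unfolding s_def by (intro prime_product_power prime_product_fps_const ufd \<open>c \<noteq> 0\<close>)
    show "e dvd h * b" using h by (simp add: low_def Q_def)
    fix q assume "e dvd q * b"
    then have "q \<in> Q" by (simp add: Q_def)
    obtain w r where wr: "q = w * e + r" "\<forall>i\<ge>m. r $ i = 0" using division by blast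
    have "q - w * e \<in> Q" using \<open>q \<in> Q\<close> by (intro Q_diff Q_mult e_Q)
    then have "r \<in> Q" using wr(1) by simp
    then have "h dvd s * r" unfolding s_def using wr(2) by (intro pseudo) auto
    moreover have "h dvd w * (s * e)" using he by (rule dvd_mult)
    moreover have "s * q = w * (s * e) + s * r" unfolding wr(1) by (simp add: algebra_simps)
    ultimately show "h dvd s * q" by simp
  qed
qed

text \<open>After exchanging the variables, the coefficient ring is R[[y]] and \<open>fps_X\<close>
  is x; R[[x]] and R[[y]] are the same type, so the hypotheses on \<open>'a fps\<close> serve for
  both.\<close>

lemma regular_irreducible_prime:
  fixes e :: "'a :: comm_ring_1 fps fps"
  assumes dom: "int_dom TYPE('a fps)" and noeth: "noetherian TYPE('a fps)"
    and ufd: "\<And>c :: 'a fps. c \<noteq> 0 \<Longrightarrow> prime_product c"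
    and irr: "comm_semiring_1_class.irreducible e"
    and e: "e $ 0 = fps_X ^ m * u" "u dvd 1"
  shows "prime_elem e"
proof -
  obtain v where v: "v dvd 1" "\<And>n i. m < i \<Longrightarrow> (v * e) $ n $ i = 0"
    using weierstrass_preparation[OF e] by blast
  have "prime_elem (fps_swap e)"
  proof (rule prime_elem_of_weierstrass[OF dom noeth ufd])
    show "comm_semiring_1_class.irreducible (fps_swap e)"
      using irr by (simp add: fps_swap.irreducible_iff)
    show "fps_swap v dvd 1"
      using v(1) fps_swap.dvd_iff[of v 1] by (simp add: fps_swap.one)
    show "(fps_swap v * fps_swap e) $ i = 0" if "m < i" for i
      using v(2)[OF that] by (simp add: fps_swap_mult[symmetric] fps_eq_iff)
    fix f
    obtain q r where qr: "fps_swap f = q * e + r" "\<forall>n i. m \<le> i \<longrightarrow> r $ n $ i = 0"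
      using weierstrass_division[OF e] by blast
    have "f = fps_swap (q * e + r)" by (simp add: qr(1)[symmetric])
    then have "f = fps_swap q * fps_swap e + fps_swap r"
      by (simp add: fps_swap_add fps_swap_mult)
    moreover have "\<forall>i\<ge>m. fps_swap r $ i = 0" using qr(2) by (simp add: fps_eq_iff)
    ultimately show "\<exists>q r. f = q * fps_swap e + r \<and> (\<forall>i\<ge>m. r $ i = 0)" by blast
  qed
  then show ?thesis by (simp add: fps_swap.prime_elem_iff)
qed

text \<open>Since x is prime, it divides one of the factors and can be cancelled; induction on
  m.\<close>

lemma mult_eq_fps_X_power:
  fixes a b :: "'a :: comm_ring_1 fps"
  assumes dom: "int_dom TYPE('a)" and "a * b = fps_X ^ m * u" "u dvd 1"
  shows "\<exists>i j s t. a = fps_X ^ i * s \<and> b = fps_X ^ j * t \<and> s dvd 1 \<and> t dvd 1 \<and> i + j = m"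
  using assms(2)
proof (induction m arbitrary: a b)
  case 0
  then have "a dvd 1" "b dvd 1"
    using \<open>u dvd 1\<close> by (metis dvd_mult_left dvd_mult_right mult_1 power_0)+
  then show ?case by (intro exI[of _ 0] exI[of _ a] exI[of _ b]) auto
next
  case (Suc m)
  note cancel = int_dom_mult_cancel[OF int_dom_fps[OF dom] fps_X_neq_zero]
  have "fps_X dvd a * b" unfolding Suc.prems by (simp add: mult.assoc)
  then have "fps_X dvd a \<or> fps_X dvd b"
    by (rule prime_elem_dvd_multD[OF prime_elem_fps_X[OF dom]])
  then consider a' where "a = fps_X * a'" | b' where "b = fps_X * b'"
    unfolding dvd_def by blast
  then show ?case
  proof cases
    case 1
    then have "fps_X * (a' * b) = fps_X * (fps_X ^ m * u)"
      using Suc.prems by (simp add: mult.assoc)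
    then have IH: "a' * b = fps_X ^ m * u" by (rule cancel)
    obtain i j s t where ij: "a' = fps_X ^ i * s" "b = fps_X ^ j * t" "s dvd 1" "t dvd 1" "i + j = m"
      using Suc.IH[OF IH] by auto
    have a: "a = fps_X ^ Suc i * s" and sum: "Suc i + j = Suc m"
      using 1 ij(1,5) by (simp_all add: mult.assoc)
    show ?thesis
      by (intro exI[of _ "Suc i"] exI[of _ j] exI[of _ s] exI[of _ t] conjI a sum ij)
  next
    case 2
    then have "fps_X * (a * b') = fps_X * (fps_X ^ m * u)"
      using Suc.prems by (simp add: mult.assoc mult.left_commute)
    then have IH: "a * b' = fps_X ^ m * u" by (rule cancel)
    obtain i j s t where ij: "a = fps_X ^ i * s" "b' = fps_X ^ j * t" "s dvd 1" "t dvd 1" "i + j = m"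
      using Suc.IH[OF IH] by auto
    have b: "b = fps_X ^ Suc j * t" and sum: "i + Suc j = Suc m"
      using 2 ij(2,5) by (simp_all add: mult.assoc)
    show ?thesis
      by (intro exI[of _ i] exI[of _ "Suc j"] exI[of _ s] exI[of _ t] conjI b sum ij)
  qed
qed

text \<open>Induction on m: a factorization of e into nonunits splits x^m into x^i and x^j with both
  exponents positive, hence both below m. Irreducible e are covered by
  \<open>regular_irreducible_prime\<close>.\<close>

lemma regular_prime_product:
  fixes e :: "'a :: comm_ring_1 fps fps"
  assumes dom: "int_dom TYPE('a fps)" and noeth: "noetherian TYPE('a fps)"
    and ufd: "\<And>c :: 'a fps. c \<noteq> 0 \<Longrightarrow> prime_product c"
    and e: "e $ 0 = fps_X ^ m * u" "u dvd 1"
  shows "prime_product e"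
  using e
proof (induction m arbitrary: e u rule: less_induct)
  case (less m)
  show ?case
  proof (cases "e dvd 1 \<or> comm_semiring_1_class.irreducible e")
    case True
    then show ?thesis
      using regular_irreducible_prime[OF dom noeth ufd _ less.prems]
        prime_product.mult[of e 1] prime_product.unit by auto
  next
    case False
    have "e $ 0 \<noteq> 0"
    proof
      assume "e $ 0 = 0"
      then have "0 dvd u * fps_X ^ m" using less.prems(1) by (simp add: mult.commute)
      then have "0 dvd (fps_X ^ m :: 'a fps)" by (rule dvd_1_mult_dvd[OF less.prems(2)])
      then have "(fps_X ^ m :: 'a fps) $ m = 0" by simp
      then show False by simp
    qed
    then have "e \<noteq> 0" by auto
    then obtain f g where fg: "e = f * g" "\<not> f dvd 1" "\<not> g dvd 1"
      using False by (auto simp: comm_semiring_1_class.irreducible_def)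
    then have fg0: "f $ 0 * g $ 0 = fps_X ^ m * u" using less.prems by simp
    obtain i j s t where ij: "f $ 0 = fps_X ^ i * s" "g $ 0 = fps_X ^ j * t"
        "s dvd 1" "t dvd 1" "i + j = m"
      using mult_eq_fps_X_power[OF int_dom_of_fps[OF dom] fg0 less.prems(2)] by auto
    have "i \<noteq> 0" "j \<noteq> 0"
      using fg(2,3) ij(1-4) by (metis fps_dvd_1_iff mult_1 power_0)+
    then have "prime_product f" "prime_product g"
      using less.IH[of i f s] less.IH[of j g t] ij by auto
    then show ?thesis unfolding fg(1) by (rule prime_product_mult)
  qed
qed

section \<open>Reduction modulo a variable\<close>

text \<open>Common prime factors of a and b are moved one by one into d; a prime of a that does not
  divide the rest of b stays in \<alpha>. In effect, (a : b) is generated by \<alpha>.\<close>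

lemma reduce_fraction:
  fixes a b :: "'a :: comm_ring_1"
  assumes dom: "int_dom TYPE('a)" and "prime_product a" "a \<noteq> 0"
  shows "\<exists>d \<alpha> \<beta>. a = d * \<alpha> \<and> b = d * \<beta> \<and> (\<forall>c. \<alpha> dvd c * \<beta> \<longrightarrow> \<alpha> dvd c)"
  using assms(2,3)
proof (induction a arbitrary: b rule: prime_product.induct)
  case (unit u)
  have "\<forall>c. u dvd c" using unit.hyps dvd_trans one_dvd by blast
  then show ?case by (intro exI[of _ 1] exI[of _ u] exI[of _ b]) simp
next
  case (mult p s)
  have "s \<noteq> 0" using mult.prems by auto
  show ?case
  proof (cases "p dvd b")
    case True
    then obtain b' where b': "b = p * b'" by (rule dvdE)
    obtain d \<alpha> \<beta> where IH: "s = d * \<alpha>" "b' = d * \<beta>" "\<forall>c. \<alpha> dvd c * \<beta> \<longrightarrow> \<alpha> dvd c"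
      using mult.IH[OF \<open>s \<noteq> 0\<close>, of b'] by auto
    show ?thesis
      by (intro exI[of _ "p * d"] exI[of _ \<alpha>] exI[of _ \<beta>] conjI IH(3))
        (simp_all only: b' IH(1,2) mult.assoc)
  next
    case False
    obtain d \<alpha> \<beta> where IH: "s = d * \<alpha>" "b = d * \<beta>" "\<forall>c. \<alpha> dvd c * \<beta> \<longrightarrow> \<alpha> dvd c"
      using mult.IH[OF \<open>s \<noteq> 0\<close>, of b] by auto
    have "\<alpha> \<noteq> 0" using IH(1) \<open>s \<noteq> 0\<close> by auto
    have "p * \<alpha> dvd c" if c: "p * \<alpha> dvd c * \<beta>" for c
    proof -
      have "\<alpha> dvd c" using c IH(3) dvd_mult_right by blast
      then obtain c' where c': "c = \<alpha> * c'" by (rule dvdE)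
      obtain r where "c * \<beta> = p * \<alpha> * r" using c by (rule dvdE)
      then have "\<alpha> * (c' * \<beta>) = \<alpha> * (p * r)" unfolding c' by (simp only: ac_simps)
      then have "c' * \<beta> = p * r" by (rule int_dom_mult_cancel[OF dom \<open>\<alpha> \<noteq> 0\<close>])
      then have "p dvd c' \<or> p dvd \<beta>"
        using prime_elem_dvd_multD[OF mult.hyps(1), of c' \<beta>] by simp
      moreover have "\<not> p dvd \<beta>" using False IH(2) by auto
      ultimately show ?thesis unfolding c' by (simp add: mult.commute[of \<alpha>] mult_dvd_mono)
    qed
    moreover have "p * s = d * (p * \<alpha>)" unfolding IH(1) by (simp only: ac_simps)
    ultimately show ?thesis using IH(2) by blast
  qed
qed

text \<open>Nakayama's lemma over the localization at the elements with constant term a power of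
  \<open>\<xi>\<close>, where \<open>X\<close> lies in the Jacobson radical.\<close>

lemma nakayama_fps:
  fixes F :: "'a :: comm_ring_1 fps set"
  assumes "finite F"
    and "\<And>q. q \<in> F \<Longrightarrow> \<exists>s k. s $ 0 = \<xi> ^ k \<and> (\<exists>h\<in>ring_ideal.span F. g dvd s * q - fps_X * h)"
  shows "\<exists>s k. s $ 0 = \<xi> ^ k \<and> (\<forall>q\<in>F. g dvd s * q)"
  using assms
proof (induction F rule: finite_induct)
  case empty
  show ?case by (intro exI[of _ 1] exI[of _ 0]) simp
next
  case (insert q F)
  obtain s k h where s: "s $ 0 = \<xi> ^ k" "h \<in> ring_ideal.span (insert q F)" "g dvd s * q - fps_X * h"
    using insert.prems by blast
  obtain a where a: "h - a * q \<in> ring_ideal.span F"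
    using s(2) unfolding ring_ideal.span_insert by blast
  \<comment> \<open>Solve the relation for q: modulo g, t q equals X (h - a q), where
    \<open>h - a * q\<close> is in the span of F.\<close>
  define t where "t = s - fps_X * a"
  have t0: "t $ 0 = \<xi> ^ k" using s(1) by (simp add: t_def)
  have "t * q - fps_X * (h - a * q) = s * q - fps_X * h"
    by (simp add: t_def algebra_simps)
  then have tq: "g dvd t * q - fps_X * (h - a * q)" using s(3) by simp
  have "\<exists>s k. s $ 0 = \<xi> ^ k \<and> (\<exists>h\<in>ring_ideal.span F. g dvd s * q' - fps_X * h)"
    if q': "q' \<in> F" for q'
  proof -
    obtain s' k' h' where s': "s' $ 0 = \<xi> ^ k'" "h' \<in> ring_ideal.span (insert q F)"
        "g dvd s' * q' - fps_X * h'"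
      using insert.prems q' by blast
    obtain a' where a': "h' - a' * q \<in> ring_ideal.span F"
      using s'(2) unfolding ring_ideal.span_insert by blast
    \<comment> \<open>Multiply the relation for q' by t and replace t q by the relation just solved,
      so that only F remains.\<close>
    define h'' where "h'' = t * (h' - a' * q) + (fps_X * a') * (h - a * q)"
    have "h'' \<in> ring_ideal.span F"
      unfolding h''_def by (intro ring_ideal.span_add ring_ideal.span_scale a a')
    moreover have "t * s' * q' - fps_X * h'' =
        t * (s' * q' - fps_X * h') + fps_X * a' * (t * q - fps_X * (h - a * q))"
      by (simp add: h''_def algebra_simps)
    then have "g dvd t * s' * q' - fps_X * h''"
      using s'(3) tq by (simp only: dvd_add dvd_mult)
    moreover have "(t * s') $ 0 = \<xi> ^ (k + k')" by (simp add: t0 s'(1) power_add)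
    ultimately show ?thesis by blast
  qed
  then obtain s' k' where s': "s' $ 0 = \<xi> ^ k'" "\<forall>q\<in>F. g dvd s' * q"
    using insert.IH by auto
  have "ring_ideal.subspace {z. g dvd s' * z}"
    by (rule ring_ideal.subspaceI) (simp_all add: distrib_left mult.left_commute[of s'] dvd_mult)
  then have "g dvd s' * (h - a * q)"
    using ring_ideal.span_minimal[of F "{z. g dvd s' * z}"] s'(2) a by blast
  then have "g dvd s' * (t * q - fps_X * (h - a * q)) + fps_X * (s' * (h - a * q))"
    using tq by (simp only: dvd_add dvd_mult)
  moreover have "s' * (t * q - fps_X * (h - a * q)) + fps_X * (s' * (h - a * q)) = s' * t * q"
    by (simp add: algebra_simps)
  ultimately have "g dvd s' * t * q" by simp
  moreover have "g dvd s' * t * z" if "z \<in> F" for z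
  proof -
    have "g dvd t * (s' * z)" using s'(2) that by (simp add: dvd_mult)
    then show ?thesis by (simp only: ac_simps)
  qed
  moreover have "(s' * t) $ 0 = \<xi> ^ (k' + k)" by (simp add: t0 s'(1) power_add)
  ultimately show ?case by blast
qed

text \<open>Applied with R[[x]] for \<open>'a\<close>, y for \<open>fps_X\<close> and x for \<xi>.
  The hypothesis \<open>torsion\<close> makes it possible to lift the generator of the colon ideal
  at y = 0, up to a power of x, to an element g of (a : b).\<close>

lemma prime_elem_of_torsion_bound:
  fixes a b :: "'a :: comm_ring_1 fps" and \<xi> :: 'a
  assumes dom: "int_dom TYPE('a)" and noeth: "noetherian TYPE('a fps)"
    and ufd: "\<And>c :: 'a. c \<noteq> 0 \<Longrightarrow> prime_product c"
    and reg: "\<And>(s :: 'a fps) k. s $ 0 = \<xi> ^ k \<Longrightarrow> prime_product s"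
    and irr: "comm_semiring_1_class.irreducible a"
    and b: "\<not> a dvd b" "\<And>x y. a dvd x * y * b \<Longrightarrow> a dvd x * b \<or> a dvd y * b"
    and torsion: "\<And>w. \<exists>l r. fps_X * w = l * a + r * b \<Longrightarrow>
      \<exists>k l r. fps_const (\<xi> ^ k) * w = l * a + r * b"
  shows "prime_elem a"
proof (cases "a dvd fps_X * b \<or> a $ 0 = 0")
  case True
  then show ?thesis
  proof
    assume "a dvd fps_X * b"
    then show ?thesis
      by (rule prime_elem_of_prime_in_colon[OF int_dom_fps[OF dom] irr b(1) prime_elem_fps_X[OF dom]])
  next
    assume "a $ 0 = 0"
    then have "fps_X dvd a" by (simp add: fps_X_dvd_iff)
    then obtain c where c: "a = fps_X * c" by (rule dvdE)
    then have "c dvd 1"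
      using irr prime_elem_fps_X[OF dom]
      by (metis comm_semiring_1_class.irreducible_def prime_elem_not_unit)
    then show ?thesis
      unfolding c by (rule prime_elem_associated[OF prime_elem_fps_X[OF dom]])
  qed
next
  case False
  then have X: "\<not> a dvd fps_X * b" and a0: "a $ 0 \<noteq> 0" by auto
  obtain d \<alpha> \<beta> where red: "a $ 0 = d * \<alpha>" "b $ 0 = d * \<beta>"
      "\<forall>c. \<alpha> dvd c * \<beta> \<longrightarrow> \<alpha> dvd c"
    using reduce_fraction[OF dom ufd[OF a0] a0, of "b $ 0"] by auto
  have "d \<noteq> 0" using red(1) a0 by auto
  \<comment> \<open>This combination lies in (a, b) and is divisible by y; the quotient w is the
    torsion element to which the hypothesis is applied.\<close>
  have "(fps_const \<alpha> * b - fps_const \<beta> * a) $ 0 = 0" by (simp add: red)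
  then obtain w where w: "fps_const \<alpha> * b - fps_const \<beta> * a = fps_X * w"
    unfolding fps_X_dvd_iff[symmetric] by (rule dvdE)
  then have "fps_X * w = - fps_const \<beta> * a + fps_const \<alpha> * b" 
    unfolding w[symmetric] by (simp only: diff_conv_add_uminus minus_mult_left add.commute)
  then obtain k l r where klr: "fps_const (\<xi> ^ k) * w = l * a + r * b"
    using torsion by blast
  \<comment> \<open>Multiplying \<alpha> b - \<beta> a = y w by \<xi>^k and moving the term y r b to
    the left turns g b into a multiple of a.\<close>
  define g where "g = fps_const (\<xi> ^ k) * fps_const \<alpha> - fps_X * r"
  have g0: "g $ 0 = \<xi> ^ k * \<alpha>" by (simp add: g_def)
  have "g * b = fps_const (\<xi> ^ k) * (fps_const \<alpha> * b - fps_const \<beta> * a)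
      + fps_const (\<xi> ^ k) * fps_const \<beta> * a - fps_X * r * b"
    unfolding g_def by (simp only: algebra_simps)
  also have "\<dots> = fps_X * (fps_const (\<xi> ^ k) * w) + fps_const (\<xi> ^ k) * fps_const \<beta> * a - fps_X * r * b"
    unfolding w by (simp only: ac_simps)
  also have "\<dots> = a * (fps_X * l + fps_const (\<xi> ^ k) * fps_const \<beta>)"
    unfolding klr by (simp only: algebra_simps)
  finally have gQ: "a dvd g * b" by simp
  define Q where "Q = {q. a dvd q * b}"
  have "ring_ideal.subspace Q"
    by (rule ring_ideal.subspaceI) (simp_all add: Q_def distrib_right mult.assoc dvd_mult)
  then obtain F where F: "finite F" "Q = ring_ideal.span F"
    using noeth unfolding noetherian_def by blast
  have "\<exists>s k. s $ 0 = \<xi> ^ k \<and> (\<exists>h\<in>ring_ideal.span F. g dvd s * q - fps_X * h)" if q: "q \<in> F" for q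
  proof -
    have "q \<in> Q" using q F(2) ring_ideal.span_base by blast
    then have "a dvd q * b" by (simp add: Q_def)
    then obtain c where "q * b = a * c" by (rule dvdE)
    then have "q $ 0 * b $ 0 = a $ 0 * c $ 0" by (metis fps_mult_nth_0)
    then have "d * (q $ 0 * \<beta>) = d * (\<alpha> * c $ 0)" unfolding red(1,2) by (simp only: ac_simps)
    then have "q $ 0 * \<beta> = \<alpha> * c $ 0" by (rule int_dom_mult_cancel[OF dom \<open>d \<noteq> 0\<close>])
    then have "\<alpha> dvd q $ 0" using red(3) by simp
    then obtain c' where c': "q $ 0 = \<alpha> * c'" by (rule dvdE)
    have "(fps_const (\<xi> ^ k) * q - fps_const c' * g) $ 0 = 0" by (simp add: c' g0)
    then obtain h where h: "fps_const (\<xi> ^ k) * q - fps_const c' * g = fps_X * h"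
      unfolding fps_X_dvd_iff[symmetric] by (rule dvdE)
    \<comment> \<open>The product y h lies in the prime ideal Q and y does not, so h lies in Q, as
      Nakayama's lemma requires.\<close>
    have "a dvd fps_const (\<xi> ^ k) * (q * b) - fps_const c' * (g * b)"
      by (rule dvd_diff[OF dvd_mult[OF \<open>a dvd q * b\<close>] dvd_mult[OF gQ]])
    also have "\<dots> = fps_X * h * b" unfolding h[symmetric] by (simp only: algebra_simps)
    finally have "a dvd h * b" using b(2) X by blast
    then have "h \<in> ring_ideal.span F" unfolding F(2)[symmetric] by (simp add: Q_def)
    moreover have "fps_const (\<xi> ^ k) * q - fps_X * h = fps_const c' * g"
      unfolding h[symmetric] by simp
    then have "g dvd fps_const (\<xi> ^ k) * q - fps_X * h" by simp
    moreover have "fps_const (\<xi> ^ k) $ 0 = \<xi> ^ k" by simp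
    ultimately show ?thesis by blast
  qed
  then obtain s k' where s: "s $ 0 = \<xi> ^ k'" "\<forall>q\<in>F. g dvd s * q"
    using nakayama_fps[OF F(1), of \<xi> g] by auto
  have "ring_ideal.subspace {z. g dvd s * z}"
    by (rule ring_ideal.subspaceI) (simp_all add: distrib_left mult.left_commute[of s] dvd_mult)
  then have "Q \<subseteq> {z. g dvd s * z}"
    unfolding F(2) using s(2) by (intro ring_ideal.span_minimal) auto
  then show ?thesis
    by (intro prime_elem_of_colon[OF int_dom_fps[OF dom] irr b reg[OF s(1)] gQ]) (auto simp: Q_def)
qed

text \<open>The annihilators of the \<open>t n\<close> modulo the \<open>x\<close>-saturation of \<open>I\<close> are independent, because
  differences of the \<open>t n\<close> act injectively there; so by Noetherianity one of them vanishes.\<close>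

lemma exists_torsion_bound:
  fixes I :: "'a :: comm_ring_1 set" and t :: "nat \<Rightarrow> 'a"
  assumes noeth: "noetherian TYPE('a)" and I: "ring_ideal.subspace I"
    and t: "\<And>m n. m < n \<Longrightarrow> \<exists>j u. u dvd 1 \<and> t m - t n = x ^ j * u"
  shows "\<exists>n. \<forall>w. t n * w \<in> I \<longrightarrow> (\<exists>k. x ^ k * w \<in> I)"
proof (rule ccontr)
  assume "\<not> ?thesis"
  then have "\<forall>n. \<exists>w. t n * w \<in> I \<and> (\<forall>k. x ^ k * w \<notin> I)" by blast
  then obtain w where w: "\<And>n. t n * w n \<in> I" "\<And>n k. x ^ k * w n \<notin> I"
    by metis
  \<comment> \<open>Adjoin the counterexamples one after another; when the chain stops,
    \<open>w N\<close> lies in \<open>J N\<close>.\<close>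
  define J where "J n = ring_ideal.span (I \<union> w ` {..<n})" for n
  have J_Suc: "J n \<subseteq> J (Suc n)" for n
    unfolding J_def by (rule ring_ideal.span_mono) auto
  have J_ideal: "ring_ideal.subspace (J n)" for n
    by (simp add: J_def)
  obtain N where N: "\<And>n. n \<ge> N \<Longrightarrow> J n = J N"
    using noetherian_chain[OF noeth, of J, OF J_ideal J_Suc] by auto
  have "w N \<in> J (Suc N)" unfolding J_def by (rule ring_ideal.span_base) auto
  then have wJ: "w N \<in> J N" using N[of "Suc N"] by simp
  \<comment> \<open>The product of the earlier \<open>t i\<close> maps all generators of
    \<open>J N\<close>, hence also \<open>w N\<close>, into I.\<close>
  have "ring_ideal.subspace {z. (\<Prod>i<N. t i) * z \<in> I}"
    using ring_ideal.subspace_0[OF I] ring_ideal.subspace_add[OF I] ring_ideal.subspace_scale[OF I]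
    by (intro ring_ideal.subspaceI) (simp_all add: distrib_left mult.left_commute[of "prod t _"])
  moreover have "(\<Prod>i<N. t i) * w j \<in> I" if "j < N" for j
  proof -
    have "(\<Prod>i<N. t i) = (\<Prod>i\<in>{..<N}-{j}. t i) * t j"
      using that by (subst prod.remove[of _ j]) (auto simp: mult.commute)
    then show ?thesis
      using ring_ideal.subspace_scale[OF I w(1)] by (simp add: mult.assoc)
  qed
  then have "I \<union> w ` {..<N} \<subseteq> {z. (\<Prod>i<N. t i) * z \<in> I}"
    using ring_ideal.subspace_scale[OF I] by auto
  ultimately have "J N \<subseteq> {z. (\<Prod>i<N. t i) * z \<in> I}"
    unfolding J_def by (rule ring_ideal.span_minimal[rotated])
  then have "(\<Prod>i<N. t i) * (x ^ 0 * w N) \<in> I" using wJ by auto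
  \<comment> \<open>The factors are stripped off one by one: both \<open>t M\<close> and
    \<open>t N\<close> multiply z into I, so their difference x^j u does, and only the power of x
    grows.\<close>
  moreover have "(\<Prod>i<M. t i) * (x ^ k * w N) \<notin> I" if "M \<le> N" for M k
    using that
  proof (induction M arbitrary: k)
    case 0
    then show ?case using w(2) by simp
  next
    case (Suc M)
    define z where "z = (\<Prod>i<M. t i) * (x ^ k * w N)"
    show ?case
    proof
      assume "(\<Prod>i<Suc M. t i) * (x ^ k * w N) \<in> I"
      then have "t M * z \<in> I" by (simp add: z_def ac_simps)
      moreover have "(\<Prod>i<M. t i) * x ^ k * (t N * w N) \<in> I"
        by (rule ring_ideal.subspace_scale[OF I w(1)])
      then have "t N * z \<in> I" by (simp add: z_def ac_simps)
      ultimately have diff: "(t M - t N) * z \<in> I"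
        unfolding left_diff_distrib by (rule ring_ideal.subspace_diff[OF I])
      obtain j u where ju: "u dvd 1" "t M - t N = x ^ j * u"
        using t[of M N] Suc.prems by auto
      obtain v where v: "1 = u * v" using ju(1) by (rule dvdE)
      have "v * (x ^ j * u * z) \<in> I"
        using ring_ideal.subspace_scale[OF I diff] unfolding ju(2) .
      also have "v * (x ^ j * u * z) = u * v * (x ^ j * z)" by (simp only: ac_simps)
      also have "\<dots> = (\<Prod>i<M. t i) * (x ^ (j + k) * w N)"
        unfolding v[symmetric] by (simp add: z_def power_add ac_simps)
      finally show False using Suc.IH[of "j + k"] Suc.prems by simp
    qed
  qed
  ultimately show False by blast
qed

section \<open>Translations\<close>

text \<open>Membership in the ideal (x, y)^M; identities between translations are verified modulo
  every such power.\<close>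

definition vanish :: "nat \<Rightarrow> 'a :: comm_ring_1 fps fps \<Rightarrow> bool"
  where "vanish M f \<longleftrightarrow> (\<forall>i k. i + k < M \<longrightarrow> f $ i $ k = 0)"

lemma vanish_mult:
  assumes "vanish M f" "vanish N g"
  shows "vanish (M + N) (f * g)"
  unfolding vanish_def
proof (intro allI impI)
  fix i k assume ik: "i + k < M + N"
  have "f $ j $ l * g $ (i - j) $ (k - l) = 0" if "j \<le> i" "l \<le> k" for j l
  proof (cases "j + l < M")
    case False
    then have "i - j + (k - l) < N" using ik that by linarith
    then show ?thesis using assms(2) by (simp add: vanish_def)
  qed (use assms(1) in \<open>simp add: vanish_def\<close>)
  then show "(f * g) $ i $ k = 0"
    unfolding fps_fps_ring_ops_nth(4) by (intro sum.neutral ballI) auto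
qed

lemma vanish_diff:
  assumes "vanish M f" "vanish N g" "K \<le> M" "K \<le> N"
  shows "vanish K (f - g)"
  using assms by (simp add: vanish_def)

lemma eqI_vanish:
  assumes "\<And>M. vanish M (f - g)"
  shows "f = g"
proof (intro fps_ext)
  fix i k
  show "f $ i $ k = g $ i $ k"
    using assms[of "Suc (i + k)"] by (simp add: vanish_def)
qed

text \<open>The substitution \<open>y \<mapsto> y - u\<close> for \<open>u\<close> without constant term; only summands with
  \<open>j \<le> i + k\<close> contribute to the coefficient of \<open>x^k y^i\<close>.\<close>

definition fps_translate :: "'a :: comm_ring_1 fps \<Rightarrow> 'a fps fps \<Rightarrow> 'a fps fps"
  where "fps_translate u f = Abs_fps (\<lambda>i. Abs_fps (\<lambda>k.
    (\<Sum>j\<le>i + k. fps_const (f $ j) * (fps_X - fps_const u) ^ j) $ i $ k))"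

context
  fixes u :: "'a :: comm_ring_1 fps"
  assumes u0: "u $ 0 = 0"
begin

lemma vanish_power: "vanish j ((fps_X - fps_const u) ^ j)"
proof (induction j)
  case (Suc j)
  have "vanish 1 (fps_X - fps_const u)"
    using u0 by (simp add: vanish_def)
  from vanish_mult[OF this Suc] show ?case by simp
qed (simp add: vanish_def)

text \<open>The j-th summand has order at least j, since u has no constant term.\<close>

lemma vanish_translate:
  "vanish (Suc M) (fps_translate u f - (\<Sum>j\<le>M. fps_const (f $ j) * (fps_X - fps_const u) ^ j))"
  unfolding vanish_def
proof (intro allI impI)
  fix i k assume ik: "i + k < Suc M"
  have "(fps_const (f $ j) * (fps_X - fps_const u) ^ j) $ i $ k = 0" if "i + k < j" for j
    using vanish_mult[OF _ vanish_power[of j], of 0 "fps_const (f $ j)"] that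
    by (simp add: vanish_def)
  then have "(\<Sum>j\<le>M. fps_const (f $ j) * (fps_X - fps_const u) ^ j) $ i $ k =
      (\<Sum>j\<le>i + k. fps_const (f $ j) * (fps_X - fps_const u) ^ j) $ i $ k"
    unfolding fps_sum_nth using ik by (intro sum.mono_neutral_right) auto
  then show "(fps_translate u f - (\<Sum>j\<le>M. fps_const (f $ j) * (fps_X - fps_const u) ^ j)) $ i $ k = 0"
    by (simp add: fps_translate_def)
qed

lemma fps_translate_add: "fps_translate u (f + g) = fps_translate u f + fps_translate u g"
  by (simp add: fps_eq_iff fps_translate_def fps_const_add[symmetric] distrib_right sum.distrib
      del: fps_const_add)

text \<open>The identity is exact for the truncations \<open>T\<close>, which approximate both sides
  to arbitrary order.\<close>

lemma fps_translate_const_mult: "fps_translate u (fps_const c * f) = fps_const c * fps_translate u f"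
proof (rule eqI_vanish)
  fix M
  define T where "T f = (\<Sum>j\<le>M. fps_const (f $ j) * (fps_X - fps_const u) ^ j)" for f
  have "T (fps_const c * f) = fps_const c * T f"
    by (simp add: T_def sum_distrib_left fps_const_mult[symmetric] mult.assoc del: fps_const_mult)
  then have eq: "fps_translate u (fps_const c * f) - fps_const c * fps_translate u f =
      (fps_translate u (fps_const c * f) - T (fps_const c * f)) - fps_const c * (fps_translate u f - T f)"
    by (simp add: algebra_simps)
  have v: "vanish (Suc M) (fps_translate u (fps_const c * f) - T (fps_const c * f))"
    unfolding T_def by (rule vanish_translate)
  have v': "vanish (0 + Suc M) (fps_const c * (fps_translate u f - T f))"
    unfolding T_def by (rule vanish_mult[OF _ vanish_translate]) (simp add: vanish_def)
  show "vanish M (fps_translate u (fps_const c * f) - fps_const c * fps_translate u f)"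
    unfolding eq by (rule vanish_diff[OF v v']) simp_all
qed

lemma fps_translate_X_mult:
  "fps_translate u (fps_X * f) = (fps_X - fps_const u) * fps_translate u f"
proof (rule eqI_vanish)
  fix M
  define T where "T M f = (\<Sum>j\<le>M. fps_const (f $ j) * (fps_X - fps_const u) ^ j)" for M f
  \<comment> \<open>Multiplication by y shifts the summands by one, so the truncation at
    \<open>Suc M\<close> matches the one at M; the summand at 0 vanishes.\<close>
  have "T (Suc M) (fps_X * f) = (fps_X - fps_const u) * T M f"
    unfolding T_def by (subst sum.atMost_Suc_shift) (simp add: sum_distrib_left mult.left_commute)
  then have eq: "fps_translate u (fps_X * f) - (fps_X - fps_const u) * fps_translate u f =
      (fps_translate u (fps_X * f) - T (Suc M) (fps_X * f)) -
      (fps_X - fps_const u) * (fps_translate u f - T M f)"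
    by (simp add: algebra_simps)
  have v: "vanish (Suc (Suc M)) (fps_translate u (fps_X * f) - T (Suc M) (fps_X * f))"
    unfolding T_def by (rule vanish_translate)
  have v': "vanish (0 + Suc M) ((fps_X - fps_const u) * (fps_translate u f - T M f))"
    unfolding T_def by (rule vanish_mult[OF _ vanish_translate]) (simp add: vanish_def)
  show "vanish M (fps_translate u (fps_X * f) - (fps_X - fps_const u) * fps_translate u f)"
    unfolding eq by (rule vanish_diff[OF v v']) simp_all
qed

lemma fps_translate_1: "fps_translate u 1 = 1"
proof (rule eqI_vanish)
  fix M
  have "(\<Sum>j\<le>M. fps_const (1 $ j) * (fps_X - fps_const u) ^ j) =
      (\<Sum>j\<le>M. if j = 0 then 1 else 0 :: 'a fps fps)"
    by (intro sum.cong) auto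
  then show "vanish M (fps_translate u 1 - 1)"
    using vanish_translate[of M 1] by (simp add: vanish_def)
qed

lemma fps_translate_const: "fps_translate u (fps_const c) = fps_const c"
  using fps_translate_const_mult[of c 1] by (simp add: fps_translate_1)

text \<open>Splitting off the constant term in y is the recursion behind the following inductions on
  the order.\<close>

lemma fps_translate_split:
  "fps_translate u f = fps_const (f $ 0) + (fps_X - fps_const u) * fps_translate u (fps_shift 1 f)"
proof -
  have f: "f = fps_const (f $ 0) + fps_X * fps_shift 1 f"
    by (auto simp: fps_eq_iff)
  show ?thesis
    by (subst f) (simp only: fps_translate_add fps_translate_const fps_translate_X_mult)
qed

text \<open>With f = f(0) + y f', the defect of multiplicativity for f is y - u times the one for
  f', so each induction step gains one order.\<close>

lemma fps_translate_mult: "fps_translate u (f * g) = fps_translate u f * fps_translate u g"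
proof (rule eqI_vanish)
  fix M
  show "vanish M (fps_translate u (f * g) - fps_translate u f * fps_translate u g)"
  proof (induction M arbitrary: f)
    case (Suc M)
    define f' where "f' = fps_shift 1 f"
    define D where "D = fps_translate u (f' * g) - fps_translate u f' * fps_translate u g"
    have f: "f = fps_const (f $ 0) + fps_X * f'"
      by (auto simp: fps_eq_iff f'_def)
    have "f * g = fps_const (f $ 0) * g + fps_X * (f' * g)"
      by (subst f) (simp only: algebra_simps)
    then have "fps_translate u (f * g) - fps_translate u f * fps_translate u g = (fps_X - fps_const u) * D"
      unfolding fps_translate_split[of f, folded f'_def] D_def
      by (simp only: fps_translate_add fps_translate_const_mult fps_translate_X_mult)
        (simp add: algebra_simps)
    moreover have "vanish (1 + M) ((fps_X - fps_const u) * D)"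
      unfolding D_def using vanish_power[of 1] by (intro vanish_mult Suc.IH) simp
    ultimately show ?case by simp
  qed (simp add: vanish_def)
qed

end

lemma fps_translate_translate:
  fixes u :: "'a :: comm_ring_1 fps"
  assumes u: "u $ 0 = 0"
  shows "fps_translate (- u) (fps_translate u f) = f"
proof (rule eqI_vanish)
  fix M
  have u': "(- u) $ 0 = 0" using u by simp
  \<comment> \<open>Here y goes to y + u, so y - u goes to y; hence the difference for f is y times
    the difference for f'.\<close>
  have X: "fps_translate (- u) (fps_X - fps_const u) = fps_X"
  proof -
    have "fps_X - fps_const u = fps_X * 1 + fps_const (- u)" by (simp flip: fps_const_neg)
    then show ?thesis
      by (simp only: fps_translate_add[OF u'] fps_translate_X_mult[OF u'] fps_translate_1[OF u']
          fps_translate_const[OF u']) (simp flip: fps_const_neg)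
  qed
  show "vanish M (fps_translate (- u) (fps_translate u f) - f)"
  proof (induction M arbitrary: f)
    case (Suc M)
    define f' where "f' = fps_shift 1 f"
    have f: "f = fps_const (f $ 0) + fps_X * f'"
      by (auto simp: fps_eq_iff f'_def)
    have "fps_translate (- u) (fps_translate u f) =
        fps_const (f $ 0) + fps_X * fps_translate (- u) (fps_translate u f')"
      unfolding fps_translate_split[OF u, of f, folded f'_def]
      by (simp only: fps_translate_add[OF u'] fps_translate_mult[OF u'] fps_translate_const[OF u'] X)
    then have "fps_translate (- u) (fps_translate u f) - f =
        fps_X * (fps_translate (- u) (fps_translate u f') - f')"
      by (subst (2) f) (simp add: algebra_simps)
    moreover have "vanish (1 + M) (fps_X * (fps_translate (- u) (fps_translate u f') - f'))"
      by (intro vanish_mult Suc.IH) (simp add: vanish_def)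
    ultimately show ?case by simp
  qed (simp add: vanish_def)
qed

lemma ring_auto_translate:
  assumes "u $ 0 = (0 :: 'a :: comm_ring_1)"
  shows "ring_auto (fps_translate u) (fps_translate (- u))"
  using fps_translate_translate[of u] fps_translate_translate[of "- u"] assms
  by unfold_locales (simp_all add: fps_translate_mult fps_translate_add)

lemma irreducible_imp_prime_fps_fps:
  fixes a :: "'a :: comm_ring_1 fps fps"
  assumes dom: "int_dom TYPE('a fps)" and noeth: "noetherian TYPE('a fps)"
    and ufd: "\<And>c :: 'a fps. c \<noteq> 0 \<Longrightarrow> prime_product c"
    and irr: "comm_semiring_1_class.irreducible a"
  shows "prime_elem a"
proof -
  have "\<not> a dvd 1" using irr by (simp add: comm_semiring_1_class.irreducible_def)
  then obtain b where b: "\<not> a dvd b" "\<And>x y. a dvd x * y * b \<Longrightarrow> a dvd x * b \<or> a dvd y * b"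
    using exists_prime_colon[OF noetherian_fps[OF noeth]] by metis
  define I where "I = ring_ideal.span {a, b}"
  have I_iff: "z \<in> I \<longleftrightarrow> (\<exists>l r. z = l * a + r * b)" for z
  proof -
    have "z \<in> I \<longleftrightarrow> (\<exists>l r. z - l * a = r * b)"
      unfolding I_def ring_ideal.span_insert[of a "{b}"] ring_ideal.span_singleton by auto
    then show ?thesis by (simp add: algebra_simps)
  qed
  \<comment> \<open>The exponent is at least 1, so that the power of x has no constant term, as
    translations require.\<close>
  define t :: "nat \<Rightarrow> 'a fps fps" where "t n = fps_X - fps_const (fps_X ^ Suc n)" for n
  have "\<exists>n. \<forall>w. t n * w \<in> I \<longrightarrow> (\<exists>k. fps_const fps_X ^ k * w \<in> I)"
  proof (rule exists_torsion_bound[OF noetherian_fps[OF noeth]])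
    show "ring_ideal.subspace I" by (simp add: I_def)
    fix m n :: nat assume "m < n"
    then have "Suc n = Suc m + (n - m)" by simp
    then have "(fps_X :: 'a fps) ^ Suc n = fps_X ^ Suc m * fps_X ^ (n - m)"
      by (metis power_add)
    \<comment> \<open>The second factor has constant term -1 and is therefore a unit.\<close>
    then have "t m - t n = fps_const fps_X ^ Suc m * fps_const (fps_X ^ (n - m) - 1)"
      by (simp add: t_def right_diff_distrib flip: fps_const_sub)
    moreover have "fps_const (fps_X ^ (n - m) - 1 :: 'a fps) dvd 1"
      using \<open>m < n\<close> by (simp add: fps_dvd_1_iff)
    ultimately show "\<exists>j u. u dvd 1 \<and> t m - t n = fps_const fps_X ^ j * u" by blast
  qed
  then obtain n where n: "\<And>w. t n * w \<in> I \<Longrightarrow> \<exists>k. fps_const (fps_X ^ k) * w \<in> I"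
    by auto
  define u :: "'a fps" where "u = fps_X ^ Suc n"
  have u0: "(- u) $ 0 = 0" by (simp add: u_def)
  interpret \<sigma>: ring_auto "fps_translate (- u)" "fps_translate u"
    using ring_auto_translate[OF u0] by simp
  interpret \<tau>: ring_auto "fps_translate u" "fps_translate (- u)"
    using ring_auto_translate[of u] u0 by simp
  \<comment> \<open>Since y is carried to \<open>t n\<close>, the inverse translation carries the
    torsion bound for \<open>t n\<close> modulo (a, b) to one for y modulo the images of a and
    b.\<close>
  have tX: "fps_translate u fps_X = t n"
    using fps_translate_X_mult[of u 1] fps_translate_1[of u] by (simp add: t_def u_def)
  have "prime_elem (fps_translate (- u) a)"
  proof (rule prime_elem_of_torsion_bound[OF dom noetherian_fps[OF noeth] ufd])
    show "prime_product s" if "s $ 0 = fps_X ^ k" for s :: "'a fps fps" and k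
      using regular_prime_product[OF dom noeth ufd, of s k 1] that by simp
    show "comm_semiring_1_class.irreducible (fps_translate (- u) a)"
      using irr by (simp add: \<sigma>.irreducible_iff)
    show "\<not> fps_translate (- u) a dvd fps_translate (- u) b"
      using b(1) by (simp add: \<sigma>.dvd_iff)
    show "fps_translate (- u) a dvd x * fps_translate (- u) b \<or>
        fps_translate (- u) a dvd y * fps_translate (- u) b"
      if "fps_translate (- u) a dvd x * y * fps_translate (- u) b" for x y
      using b(2)[of "fps_translate u x" "fps_translate u y"] that
      by (simp add: \<sigma>.dvd_iff' \<tau>.mult \<tau>.inv2)
    show "\<exists>k l r. fps_const (fps_X ^ k) * w = l * fps_translate (- u) a + r * fps_translate (- u) b"
      if lr: "\<exists>l r. fps_X * w = l * fps_translate (- u) a + r * fps_translate (- u) b" for w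
    proof -
      obtain l r where "fps_X * w = l * fps_translate (- u) a + r * fps_translate (- u) b"
        using lr by blast
      then have "fps_translate u (fps_X * w) =
          fps_translate u (l * fps_translate (- u) a + r * fps_translate (- u) b)"
        by simp
      then have "t n * fps_translate u w = fps_translate u l * a + fps_translate u r * b"
        by (simp only: \<tau>.mult \<tau>.add \<tau>.inv2 tX)
      then have "t n * fps_translate u w \<in> I" unfolding I_iff by blast
      then obtain k l' r' where "fps_const (fps_X ^ k) * fps_translate u w = l' * a + r' * b"
        using n unfolding I_iff by blast
      then have "fps_translate (- u) (fps_const (fps_X ^ k) * fps_translate u w) =
          fps_translate (- u) (l' * a + r' * b)"
        by simp
      then have "fps_const (fps_X ^ k) * w =
          fps_translate (- u) l' * fps_translate (- u) a + fps_translate (- u) r' * fps_translate (- u) b"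
        by (simp only: \<sigma>.mult \<sigma>.add \<sigma>.inv2 fps_translate_const[OF u0])
      then show ?thesis by blast
    qed
  qed
  then show ?thesis by (simp add: \<sigma>.prime_elem_iff)
qed

section \<open>Factorial domains\<close>

lemma ring_of_type_algebra_simps [simp]:
  "carrier ring_of_type_algebra = (UNIV :: 'a :: comm_ring_1 set)"
  "monoid.mult ring_of_type_algebra = ((*) :: 'a \<Rightarrow> _)"
  "x \<oplus>\<^bsub>ring_of_type_algebra\<^esub> y = x + y"
  "\<one>\<^bsub>ring_of_type_algebra\<^esub> = (1 :: 'a)"
  "\<zero>\<^bsub>ring_of_type_algebra\<^esub> = (0 :: 'a)"
  by (simp_all add: ring_of_type_algebra_def)

lemma factor_ring_of_type_algebra [simp]:
  "x divides\<^bsub>ring_of_type_algebra\<^esub> y \<longleftrightarrow> x dvd (y :: 'a :: comm_ring_1)"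
  by (simp add: factor_def dvd_def)

lemma Units_ring_of_type_algebra [simp]:
  "x \<in> Units ring_of_type_algebra \<longleftrightarrow> x dvd (1 :: 'a :: comm_ring_1)"
  by (auto simp: Units_def dvd_def mult.commute)

lemma ideal_ring_of_type_algebra_iff:
  "ideal I ring_of_type_algebra \<longleftrightarrow> ring_ideal.subspace (I :: 'a :: comm_ring_1 set)"
proof
  assume I: "ideal I ring_of_type_algebra"
  then have "additive_subgroup I ring_of_type_algebra" by (rule ideal.axioms(1))
  then show "ring_ideal.subspace I"
    using additive_subgroup.zero_closed additive_subgroup.a_closed ideal.I_l_closed[OF I]
    by (intro ring_ideal.subspaceI) fastforce+
next
  interpret R: ring "ring_of_type_algebra :: 'a ring" by (rule ring_from_type_algebra)
  assume I: "ring_ideal.subspace I"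
  show "ideal I ring_of_type_algebra"
  proof (rule idealI[OF R.ring_axioms])
    show "subgroup I (add_monoid ring_of_type_algebra)"
    proof (rule R.add.subgroupI)
      fix a assume "a \<in> I"
      have "\<ominus>\<^bsub>ring_of_type_algebra\<^esub> a = - a" by (rule R.minus_equality) simp_all
      then show "\<ominus>\<^bsub>ring_of_type_algebra\<^esub> a \<in> I"
        using ring_ideal.subspace_neg[OF I \<open>a \<in> I\<close>] by simp
    qed (use ring_ideal.subspace_0[OF I] ring_ideal.subspace_add[OF I] in auto)
  qed (use ring_ideal.subspace_scale[OF I] in \<open>auto simp: mult.commute\<close>)
qed

lemma genideal_ring_of_type_algebra:
  "Idl\<^bsub>ring_of_type_algebra\<^esub> S = ring_ideal.span (S :: 'a :: comm_ring_1 set)"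
proof -
  interpret R: ring "ring_of_type_algebra :: 'a ring" by (rule ring_from_type_algebra)
  show ?thesis
  proof
    show "Idl\<^bsub>ring_of_type_algebra\<^esub> S \<subseteq> ring_ideal.span S"
      by (intro R.genideal_minimal)
        (simp_all add: ideal_ring_of_type_algebra_iff ring_ideal.span_superset)
    show "ring_ideal.span S \<subseteq> Idl\<^bsub>ring_of_type_algebra\<^esub> S"
      by (intro ring_ideal.span_minimal R.genideal_self)
        (simp_all flip: ideal_ring_of_type_algebra_iff add: R.genideal_ideal)
  qed
qed

lemma noetherian_ring_of_type_algebra_iff:
  "noetherian_ring (ring_of_type_algebra :: 'a :: comm_ring_1 ring) \<longleftrightarrow> noetherian TYPE('a)"
  using ring_from_type_algebra[where ?'a = 'a]
  by (simp add: noetherian_ring_def noetherian_ring_axioms_def noetherian_def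
      ideal_ring_of_type_algebra_iff genideal_ring_of_type_algebra)

lemma domain_ring_of_type_algebra_iff:
  "domain (ring_of_type_algebra :: 'a :: comm_ring_1 ring) \<longleftrightarrow> int_dom TYPE('a)"
  using cring_from_type_algebra[where ?'a = 'a]
  by (simp add: domain_def domain_axioms_def int_dom_def)

text \<open>Irreducible factors are prime in a factorial monoid; the factorization determines c up
  to a unit, which \<open>prime_product\<close> absorbs.\<close>

lemma prime_product_of_factorial_domain:
  fixes c :: "'a :: comm_ring_1"
  assumes "factorial_domain (ring_of_type_algebra :: 'a ring)" and "c \<noteq> 0"
  shows "prime_product c"
proof -
  let ?R = "ring_of_type_algebra :: 'a ring"
  interpret factorial_domain ?R by fact
  have "c \<in> carrier (mult_of ?R)" using \<open>c \<noteq> 0\<close> by simp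
  then obtain fs where fs: "set fs \<subseteq> carrier (mult_of ?R)" "wfactors (mult_of ?R) fs c"
    using factorial_monoid.wfactors_exist[OF factorial_monoid_axioms] by blast
  have "prime_elem p" if "p \<in> set fs" for p
  proof -
    have "p \<in> carrier (mult_of ?R)" "Divisibility.irreducible (mult_of ?R) p"
      using fs that by (auto simp: wfactors_def)
    then have p: "p \<noteq> 0" "Divisibility.prime ?R p"
      using factorial_monoid.irreducible_prime[OF factorial_monoid_axioms, of p] prime_eq_prime_mult[of p] by auto
    then show ?thesis by (auto simp: Divisibility.prime_def prime_elem_def)
  qed
  then have prod: "prime_product (foldr (*) fs 1)"
    by (induction fs) (auto intro: prime_product.intros)
  have "foldr (*) fs 1 \<sim>\<^bsub>mult_of ?R\<^esub> c"
    using fs(2) by (simp add: wfactors_def)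
  then have "c \<sim>\<^bsub>?R\<^esub> foldr (*) fs 1"
    by (auto simp: associated_def)
  then obtain u where "u dvd 1" "c = u * foldr (*) fs 1"
    using ring_associated_iff[of c "foldr (*) fs 1"] by auto
  then show ?thesis using prod by (auto intro: prime_product_mult prime_product.unit)
qed

text \<open>Noetherianity yields factorizations into irreducibles, and the primality of irreducibles
  yields uniqueness.\<close>

lemma factorial_domain_ring_of_type_algebraI:
  assumes dom: "int_dom TYPE('a :: comm_ring_1)" and noeth: "noetherian TYPE('a)"
    and prime: "\<And>a :: 'a. comm_semiring_1_class.irreducible a \<Longrightarrow> prime_elem a"
  shows "factorial_domain (ring_of_type_algebra :: 'a ring)"
proof -
  let ?R = "ring_of_type_algebra :: 'a ring"
  interpret noetherian_domain ?R
    using dom noeth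
    by (simp add: noetherian_domain_def domain_ring_of_type_algebra_iff
        noetherian_ring_of_type_algebra_iff)
  interpret P: primeness_condition_monoid "mult_of ?R"
  proof
    fix a assume "a \<in> carrier (mult_of ?R)" "Divisibility.irreducible (mult_of ?R) a"
    then have "ring_irreducible\<^bsub>?R\<^esub> a" "a \<noteq> 0"
      using ring_irreducibleI'[of a] by auto
    then have "comm_semiring_1_class.irreducible a"
      using ring_irreducibleE(4,5)[of a] by (auto simp: comm_semiring_1_class.irreducible_def)
    then have "prime_elem a" by (rule prime)
    then have "Divisibility.prime ?R a" by (auto simp: Divisibility.prime_def prime_elem_def)
    then show "Divisibility.prime (mult_of ?R) a" using prime_eq_prime_mult[of a] by simp
  qed
  have "factorial_monoid (mult_of ?R)"
  proof (rule mult_of.factorial_monoidI)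
    show "\<exists>fs. set fs \<subseteq> carrier (mult_of ?R) \<and> wfactors (mult_of ?R) fs a"
      if "a \<in> carrier (mult_of ?R)" "a \<notin> Units (mult_of ?R)" for a
      using factorization_property[of a] that by simp
  qed (rule P.wfactors_unique, assumption+)
  then show ?thesis by (simp add: factorial_domain_def domain_axioms)
qed

theorem theorem1p1:
  assumes "noetherian_ring (ring_of_type_algebra :: 'r :: comm_ring_1 ring)"
    and "factorial_domain (ring_of_type_algebra :: 'r fps ring)"
  shows "factorial_domain (ring_of_type_algebra :: 'r fps fps ring)"
proof -
  have noeth: "noetherian TYPE('r fps)"
    using assms(1) by (simp add: noetherian_ring_of_type_algebra_iff noetherian_fps)
  have dom: "int_dom TYPE('r fps)"
    using assms(2) by (simp add: factorial_domain_def flip: domain_ring_of_type_algebra_iff)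
  show ?thesis
    by (intro factorial_domain_ring_of_type_algebraI int_dom_fps noetherian_fps dom noeth
        irreducible_imp_prime_fps_fps[OF dom noeth] prime_product_of_factorial_domain[OF assms(2)])
qed

end
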